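(* Let $\mu$ be a non-zero measure supported on a finite union of disjoint compact intervals $[a_i,b_i]$, such that $\mu$ has a density $\rho(x)$ which is absolutely continuous on each interval of support. In addition, suppose that, for some $1<p<\infty$, the restriction of $\rho(x)$ to $I$ is in $W^{1,p}(I)$ for each open interval $I\subset\Gamma$, where $\Gamma$ is the support of $\mu$, with possibly unbounded behaviour at the boundary of $\Gamma$. Let $\zeta\in\mathbb{C}$. Then the number of solutions (counted with multiplicity) to $G_\mu(z)=\zeta$ is bounded above by $$N=\frac12\,\sup_{y>0,\;y\notin S} C\bigl(\{x\in\mathbb{R}:(x,y)\in\mathcal{G}(\rho)\}\bigr),$$ where $\mathcal{G}(\rho)$ is the modified graph of $\rho(x)$ and $S$ is an arbitrary nowhere dense subset of $\mathbb{R}$.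
   Context: The Stieltjes transform of $\mu$ is $G_\mu(z)=\int_\Gamma \frac{1}{z-x}\,\mathrm{d}\mu(x)$ for $z\in\mathbb{C}\setminus\Gamma$. $W^{1,p}(I)$ is the Sobolev space on $I$, and the absolutely continuous representative of its elements is always taken. For $A\subset\mathbb{R}$, $C(A)\in\mathbb{N}\cup\{\infty\}$ denotes the number of connected components of $A$, i.e. the number of equivalence classes of the relation on $A$ under which $s\sim t$ if the closed interval between $s$ and $t$ is a subset of $A$; $C(A)=\infty$ if there are infinitely many (countably or uncountably). For a subset $U\subset\mathbb{R}$ and a function $f:U\to\mathbb{R}$ with finitely many points of discontinuity whose left and right limits exist at every point of $U$, allowing for possibly infinite limits, the modified graph of $f$ is $$\mathcal{G}(f)=\Bigl\{(x,y)\in U\times\mathbb{R}: y\text{ lies (inclusively) between }\lim_{z\uparrow x}f(z)\text{ and }\lim_{z\downarrow x}f(z)\Bigr\}.$$ *)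

theory Defs
  imports "HOL-Complex_Analysis.Complex_Analysis"
begin

section \<open>Measures on the line and the Stieltjes transform\<close>

definition measure_support :: "real measure \<Rightarrow> real set" where
  "measure_support \<mu> = {x. \<forall>U. open U \<longrightarrow> x \<in> U \<longrightarrow> emeasure \<mu> U \<noteq> 0}"

text \<open>Only meaningful for \<open>z\<close> outside the support: elsewhere the integral may diverge, in which
  case the Bochner integral is \<open>0\<close> by convention.\<close>

definition stieltjes_transform :: "real measure \<Rightarrow> complex \<Rightarrow> complex" where
  "stieltjes_transform \<mu> z = (LINT x:measure_support \<mu>|\<mu>. 1 / (z - complex_of_real x))"

text \<open>The number of solutions of \<open>f z = \<zeta>\<close> in \<open>D\<close>, counted with multiplicity (possibly infinite).
  The multiplicity of a solution is the order of the zero of \<open>f - \<zeta>\<close> there.\<close>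

definition count_solutions :: "(complex \<Rightarrow> complex) \<Rightarrow> complex set \<Rightarrow> complex \<Rightarrow> ennreal" where
  "count_solutions f D \<zeta> =
     (\<Sum>\<^sub>\<infinity>z\<in>{z \<in> D. f z = \<zeta>}. of_nat (nat (zorder (\<lambda>w. f w - \<zeta>) z)))"


section \<open>Absolute continuity and Sobolev spaces on intervals\<close>

definition abs_continuous_on :: "real set \<Rightarrow> (real \<Rightarrow> real) \<Rightarrow> bool" where
  "abs_continuous_on A f \<longleftrightarrow>
     (\<forall>\<epsilon>>0. \<exists>\<delta>>0. \<forall>D :: (real \<times> real) set.
        finite D \<and> (\<forall>(s, t)\<in>D. s \<le> t \<and> {s..t} \<subseteq> A) \<and>
        pairwise (\<lambda>(s, t) (u, v). {s<..<t} \<inter> {u<..<v} = {}) D \<and>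
        (\<Sum>(s, t)\<in>D. t - s) < \<delta>
        \<longrightarrow> (\<Sum>(s, t)\<in>D. \<bar>f t - f s\<bar>) < \<epsilon>)"

definition in_Lp :: "real \<Rightarrow> real set \<Rightarrow> (real \<Rightarrow> real) \<Rightarrow> bool" where
  "in_Lp p I f \<longleftrightarrow> set_borel_measurable lebesgue I f \<and>
     set_integrable lebesgue I (\<lambda>x. \<bar>f x\<bar> powr p)"

definition test_function :: "real set \<Rightarrow> (real \<Rightarrow> real) \<Rightarrow> bool" where
  "test_function I \<phi> \<longleftrightarrow> (\<forall>k x. (deriv ^^ k) \<phi> differentiable at x) \<and>
     (\<exists>K. compact K \<and> K \<subseteq> I \<and> (\<forall>x. x \<notin> K \<longrightarrow> \<phi> x = 0))"

definition weak_derivative_on :: "real set \<Rightarrow> (real \<Rightarrow> real) \<Rightarrow> (real \<Rightarrow> real) \<Rightarrow> bool" where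
  "weak_derivative_on I f g \<longleftrightarrow>
     (\<forall>\<phi>. test_function I \<phi> \<longrightarrow>
        (LINT x:I|lebesgue. f x * deriv \<phi> x) = - (LINT x:I|lebesgue. g x * \<phi> x))"

definition sobolev_W1 :: "real \<Rightarrow> real set \<Rightarrow> (real \<Rightarrow> real) set" where
  "sobolev_W1 p I = {f. in_Lp p I f \<and> (\<exists>g. in_Lp p I g \<and> weak_derivative_on I f g)}"


section \<open>Connected components and the modified graph\<close>

definition num_components :: "real set \<Rightarrow> enat" where
  "num_components A = (if finite (components A) then enat (card (components A)) else \<infinity>)"

lemma connected_component_real_iff:
  fixes s t :: real
  shows "connected_component A s t \<longleftrightarrow> closed_segment s t \<subseteq> A"
proof
  assume "connected_component A s t"
  then obtain T where "connected T" "T \<subseteq> A" "s \<in> T" "t \<in> T"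
    by (auto simp: connected_component_def)
  then show "closed_segment s t \<subseteq> A"
    using closed_segment_subset[of s T t] is_interval_connected_1 is_interval_convex_1 by blast
next
  assume "closed_segment s t \<subseteq> A"
  then show "connected_component A s t"
    unfolding connected_component_def
    by (intro exI[of _ "closed_segment s t"]) auto
qed

lemma components_real_eq_quotient:
  fixes A :: "real set"
  shows "components A = A // {(s, t). s \<in> A \<and> t \<in> A \<and> closed_segment s t \<subseteq> A}"
proof -
  have "connected_component_set A x = {(s, t). s \<in> A \<and> t \<in> A \<and> closed_segment s t \<subseteq> A} `` {x}"
    if "x \<in> A" for x
    using that by (auto simp: connected_component_real_iff)
  then show ?thesis
    by (auto simp: components_def quotient_def)
qed

definition left_limit :: "real set \<Rightarrow> (real \<Rightarrow> real) \<Rightarrow> real \<Rightarrow> ereal" where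
  "left_limit U f x = Lim (at x within U \<inter> {..<x}) (\<lambda>z. ereal (f z))"

definition right_limit :: "real set \<Rightarrow> (real \<Rightarrow> real) \<Rightarrow> real \<Rightarrow> ereal" where
  "right_limit U f x = Lim (at x within U \<inter> {x<..}) (\<lambda>z. ereal (f z))"

text \<open>The functions that have a modified graph; the one-sided limits may be infinite.\<close>

definition has_modified_graph :: "real set \<Rightarrow> (real \<Rightarrow> real) \<Rightarrow> bool" where
  "has_modified_graph U f \<longleftrightarrow>
     finite {x \<in> U. \<not> continuous (at x within U) f} \<and>
     (\<forall>x\<in>U. (\<exists>l. ((\<lambda>z. ereal (f z)) \<longlongrightarrow> l) (at x within U \<inter> {..<x})) \<and>
             (\<exists>r. ((\<lambda>z. ereal (f z)) \<longlongrightarrow> r) (at x within U \<inter> {x<..})))"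

definition modified_graph :: "real set \<Rightarrow> (real \<Rightarrow> real) \<Rightarrow> (real \<times> real) set" where
  "modified_graph U f = {(x, y). x \<in> U \<and>
     min (left_limit U f x) (right_limit U f x) \<le> ereal y \<and>
     ereal y \<le> max (left_limit U f x) (right_limit U f x)}"

definition nowhere_dense :: "real set \<Rightarrow> bool" where
  "nowhere_dense S \<longleftrightarrow> interior (closure S) = {}"

end

theory Submission
  imports Defs "HOL-Probability.Sinc_Integral"
begin

text \<open>
Let \<open>z\<^sub>1, \<dots>, z\<^sub>m\<close> be solutions of \<open>G z = \<zeta>\<close>, listed with multiplicity. The proof is a
sign-change argument of the kind used for zeros of orthogonal polynomials.

Suppose first that \<open>\<zeta>\<close> is not real and put \<open>y = \<bar>Im \<zeta>\<bar> / \<pi>\<close>. The principal-value Stieltjes transform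
of the constant density \<open>y\<close> is \<open>- \<i> \<pi> y\<close> in the upper and \<open>\<i> \<pi> y\<close> in the lower half-plane, while
\<open>Im (G z)\<close> and \<open>Im z\<close> have opposite signs. Hence the transform of \<open>f = \<rho> - y\<close> takes the value
\<open>Re \<zeta>\<close> at all \<open>z\<^sub>j\<close> and all \<open>cnj z\<^sub>j\<close>, and its derivatives vanish there up to the
multiplicity. Put \<open>Q x = (\<Prod>j. (x - z\<^sub>j) * (x - cnj z\<^sub>j))\<close>. If \<open>P\<close> is a polynomial of degree at
most \<open>2 m - 2\<close>, the residues of \<open>P / Q\<close> add up to zero, so that partial fractions give
\<open>\<integral> f * P / Q = 0\<close> (\<open>has_bochner_integral_partial_fractions\<close>). As \<open>Q > 0\<close>, a function \<open>f\<close> with at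
most \<open>2 m - 2\<close> sign changes would have a \<open>P\<close> that changes sign with it, and \<open>f * P / Q\<close> would not
integrate to zero (\<open>orthogonal_imp_alternates\<close>). So \<open>f\<close> has at least \<open>2 m - 1\<close> sign changes, and,
being negative far out on both sides, it has an even number of them, that is, at least \<open>2 m\<close>.

If \<open>\<zeta>\<close> is real, then all \<open>z\<^sub>j\<close> are real and outside \<open>\<Gamma>\<close>. With \<open>Q x = (\<Prod>j. x - z\<^sub>j)\<close>, now of
variable sign, the function \<open>\<rho>\<close> is orthogonal to \<open>P / Q\<close> for all \<open>P\<close> of degree at most \<open>m - 2\<close>, so
\<open>\<rho> / Q\<close> alternates in sign on \<open>m\<close> points. There \<open>\<rho>\<close> is positive, and between two consecutive
points \<open>Q\<close> has a root, where \<open>\<rho>\<close> vanishes. Thus \<open>\<rho>\<close> goes at least \<open>2 m\<close> times from one side of a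
level to the other whenever the level is positive and small.

In both cases the points of alternation can be taken at points of continuity of \<open>\<rho>\<close>, and the
alternation persists on an open interval of levels, which contains a level outside the nowhere dense
set \<open>S\<close>. Between two consecutive points the modified graph crosses the level, and different
crossings lie in different components of the level set (\<open>num_components_level_set_ge\<close>). The
level set therefore has at least \<open>2 m\<close> components.
\<close>

section \<open>Alternating lists\<close>

text \<open>Without the second conjunct every singleton would alternate.\<close>

definition alternates :: "(real \<Rightarrow> real) \<Rightarrow> real list \<Rightarrow> bool" where
  "alternates h xs \<longleftrightarrow>
     successively (\<lambda>u v. u < v \<and> h u * h v < 0) xs \<and> (\<forall>x\<in>set xs. h x \<noteq> 0)"

lemma alternates_Cons:
  "alternates h (x # xs) \<longleftrightarrow>
     h x \<noteq> 0 \<and> (xs = [] \<or> x < hd xs \<and> h x * h (hd xs) < 0) \<and> alternates h xs"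
  by (auto simp: alternates_def successively_Cons)

lemma alternates_cong_sgn:
  assumes "alternates h xs" and "\<And>x. x \<in> set xs \<Longrightarrow> sgn (k x) = sgn (h x)"
  shows "alternates k xs"
  using assms
proof (induction xs)
  case (Cons x xs)
  have nz: "k z \<noteq> 0 \<longleftrightarrow> h z \<noteq> 0" if "z \<in> set (x # xs)" for z
    using Cons.prems(2)[OF that] by (metis sgn_0_0)
  have neg: "k u * k v < 0 \<longleftrightarrow> h u * h v < 0" if "u \<in> set (x # xs)" "v \<in> set (x # xs)" for u v
    using Cons.prems(2)[OF that(1)] Cons.prems(2)[OF that(2)] sgn_mult[of "k u" "k v"]
      sgn_mult[of "h u" "h v"] by (metis sgn_less)
  have "alternates k xs"
    using Cons.IH Cons.prems by (simp add: alternates_Cons)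
  then show ?case
    using Cons.prems(1) nz neg hd_in_set[of xs] by (auto simp: alternates_Cons)
qed (simp add: alternates_def)

lemma alternates_parity:
  assumes "alternates h xs" "xs \<noteq> []"
  shows "h (hd xs) * h (last xs) * (-1) ^ length xs < 0"
  using assms
proof (induction xs)
  case (Cons x xs)
  show ?case
  proof (cases "xs = []")
    case True
    then have "h x \<noteq> 0" using Cons.prems by (simp add: alternates_Cons)
    then have "0 < h x * h x" by (auto simp: zero_less_mult_iff)
    then show ?thesis using True by simp
  next
    case False
    define e where "e = h (last xs) * (-1) ^ length xs"
    have "h (hd xs) * e < 0" "h x * h (hd xs) < 0"
      using Cons False by (auto simp: alternates_Cons e_def mult.assoc)
    then have "h x * e > 0"
      by (auto simp: mult_less_0_iff zero_less_mult_iff)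
    then show ?thesis using False by (simp add: e_def mult.assoc)
  qed
qed simp

lemma sorted_alternates:
  assumes "alternates h xs"
  shows "sorted_wrt (<) xs"
proof -
  have "successively (<) xs"
    using assms unfolding alternates_def by (auto elim: successively_mono)
  then show ?thesis
    by (subst (asm) successively_conv_sorted_wrt) (auto simp: transp_def)
qed

lemma alternates_nth:
  assumes "alternates h xs" and "Suc i < length xs"
  shows "xs ! i < xs ! Suc i" and "h (xs ! i) * h (xs ! Suc i) < 0"
  using assms
  by (induction xs arbitrary: i) (auto simp: alternates_Cons nth_Cons hd_conv_nth split: nat.splits)

text \<open>Strict inequalities at finitely many points survive a small change of the level.\<close>

lemma alternates_robust:
  assumes "alternates (\<lambda>x. f x - y) xs"
  obtains e where "0 < e" "\<And>y'. \<bar>y' - y\<bar> < e \<Longrightarrow> alternates (\<lambda>x. f x - y') xs"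
proof -
  define e where "e = Min (insert 1 ((\<lambda>x. \<bar>f x - y\<bar>) ` set xs))"
  have "0 < e" unfolding e_def using assms by (auto simp: alternates_def)
  moreover have "alternates (\<lambda>x. f x - y') xs" if y': "\<bar>y' - y\<bar> < e" for y'
  proof (rule alternates_cong_sgn[OF assms])
    fix x assume "x \<in> set xs"
    then have "e \<le> \<bar>f x - y\<bar>" unfolding e_def by (intro Min_le) auto
    then show "sgn (f x - y') = sgn (f x - y)" using y' by (auto simp: sgn_if)
  qed
  ultimately show thesis using that by blast
qed

text \<open>Putting a low point from \<open>Z\<close> between consecutive high points, and one on either side, gives
  two sign changes for each high point. The head is recorded for the induction.\<close>

lemma alternates_interleave:
  assumes "successively (\<lambda>u v. \<exists>z. u < z \<and> z < v \<and> z \<in> Z) xs"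
    and "\<forall>x\<in>set xs. 0 < h x" and "\<forall>z\<in>Z. h z < 0" and "q \<in> Z" "r \<in> Z"
    and "\<forall>x\<in>set xs. q < x \<and> x < r"
  shows "\<exists>ys. alternates h ys \<and> set ys \<subseteq> set xs \<union> Z \<and> length ys = Suc (2 * length xs) \<and> hd ys = q"
  using assms
proof (induction xs arbitrary: q)
  case Nil
  then show ?case by (intro exI[of _ "[q]"]) (auto simp: alternates_def)
next
  case (Cons x xs)
  obtain z where z: "z \<in> Z" "x < z" "\<forall>x'\<in>set xs. z < x' \<and> x' < r"
  proof (cases xs)
    case Nil
    then show ?thesis using that[of r] Cons.prems by auto
  next
    case (Cons a as)
    then obtain z where z: "x < z" "z < a" "z \<in> Z" using Cons.prems(1) by auto
    have "successively (<) xs"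
      using Cons.prems(1) by (auto simp: successively_Cons elim!: successively_mono)
    then have "sorted_wrt (<) xs"
      by (subst (asm) successively_conv_sorted_wrt) (auto simp: transp_def)
    then have "\<forall>x'\<in>set xs. a \<le> x'" using Cons by auto
    then show ?thesis using that[of z] z Cons.prems(6) by fastforce
  qed
  obtain ys where ys: "alternates h ys" "set ys \<subseteq> set xs \<union> Z" "length ys = Suc (2 * length xs)"
    "hd ys = z"
    using Cons.IH[of z] Cons.prems z by (auto simp: successively_Cons)
  have "alternates h (q # x # ys)"
    using ys z Cons.prems by (auto simp: alternates_Cons mult_less_0_iff)
  then show ?case
    using ys Cons.prems by (intro exI[of _ "q # x # ys"]) auto
qed

section \<open>Orthogonality forces sign changes\<close>

text \<open>The roots are successive infima. Let \<open>c\<close> be the infimum of the points at which \<open>s * h\<close> is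
  positive. An alternating list beyond \<open>c\<close> that starts with the opposite sign can be prolonged to
  the left by such a point, so beyond \<open>c\<close> the bound on the length drops by one. All roots are at
  least \<open>l\<close>, so the product stays positive to the left of \<open>l\<close>.\<close>

lemma sign_correcting_roots:
  assumes "E \<subseteq> {l..}"
    and "\<And>xs. \<lbrakk>alternates h xs; set xs \<subseteq> E; length xs = Suc N\<rbrakk> \<Longrightarrow> s * h (hd xs) \<le> 0"
  shows "\<exists>cs. length cs \<le> N \<and> (\<forall>c\<in>set cs. l \<le> c) \<and> (\<forall>x\<in>E. s * h x * (\<Prod>c\<leftarrow>cs. c - x) \<le> 0)"
  using assms
proof (induction N arbitrary: E l s)
  case 0
  have "s * h x \<le> 0" if "x \<in> E" for x
    using 0(2)[of "[x]"] that by (cases "h x = 0") (auto simp: alternates_def)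
  then show ?case by (intro exI[of _ "[]"]) auto
next
  case (Suc N)
  define A where "A = {x \<in> E. s * h x > 0}"
  show ?case
  proof (cases "A = {}")
    case True
    then show ?thesis by (intro exI[of _ "[]"]) (auto simp: A_def not_less)
  next
    case False
    define c where "c = Inf A"
    have bdd: "bdd_below A" using Suc.prems(1) by (auto simp: A_def intro!: bdd_belowI[of _ l])
    have "l \<le> c" unfolding c_def using False Suc.prems(1) by (intro cInf_greatest) (auto simp: A_def)
    have claim: "(- s) * h (hd xs) \<le> 0"
      if xs: "alternates h xs" "set xs \<subseteq> E \<inter> {c<..}" "length xs = Suc N" for xs
    proof (rule ccontr)
      assume neg: "\<not> (- s) * h (hd xs) \<le> 0"
      have ne: "xs \<noteq> []" using xs by auto
      then have "c < hd xs" using xs(2) hd_in_set by blast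
      then obtain a where a: "a \<in> A" "a < hd xs"
        using cInf_lessD[OF False] unfolding c_def by blast
      have sa: "s * h a > 0" using a by (simp add: A_def)
      have sh: "s * h (hd xs) < 0" using neg by simp
      have "h a * h (hd xs) < 0" using sa sh
        by (auto simp: zero_less_mult_iff mult_less_0_iff)
      then have "alternates h (a # xs)"
        using xs a sa by (auto simp: alternates_Cons)
      then have "s * h (hd (a # xs)) \<le> 0"
        using xs a by (intro Suc.prems(2)) (auto simp: A_def)
      then show False using sa by simp
    qed
    have "\<exists>cs. length cs \<le> N \<and> (\<forall>d\<in>set cs. c \<le> d) \<and>
        (\<forall>x\<in>E \<inter> {c<..}. - s * h x * (\<Prod>d\<leftarrow>cs. d - x) \<le> 0)"
      by (rule Suc.IH[OF _ claim]) auto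
    then obtain cs where cs: "length cs \<le> N" "\<forall>d\<in>set cs. c \<le> d"
      "\<forall>x\<in>E \<inter> {c<..}. - s * h x * (\<Prod>d\<leftarrow>cs. d - x) \<le> 0"
      by blast
    have "s * h x * (\<Prod>d\<leftarrow>c # cs. d - x) \<le> 0" if x: "x \<in> E" for x
    proof -
      consider "x < c" | "x = c" | "c < x" by linarith
      then show ?thesis
      proof cases
        case 1
        then have "x \<notin> A" using cInf_lower[OF _ bdd] unfolding c_def by fastforce
        then have "s * h x \<le> 0" using x by (simp add: A_def)
        moreover have "0 \<le> (\<Prod>d\<leftarrow>c # cs. d - x)"
          using 1 cs(2) by (intro prod_list_nonneg) auto
        ultimately show ?thesis by (rule mult_nonpos_nonneg)
      next
        case 3
        then have "- s * h x * (\<Prod>d\<leftarrow>cs. d - x) \<le> 0" "0 \<le> x - c"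
          using cs(3) x by auto
        then have "(- s * h x * (\<Prod>d\<leftarrow>cs. d - x)) * (x - c) \<le> 0"
          by (rule mult_nonpos_nonneg)
        then show ?thesis by (simp add: algebra_simps)
      qed simp
    qed
    then show ?thesis
      using cs \<open>l \<le> c\<close> by (intro exI[of _ "c # cs"]) auto
  qed
qed

lemma AE_in_cofinite:
  fixes A :: "real set"
  assumes "finite A"
  shows "AE x in lborel. x \<notin> A"
  using finite_imp_null_set_lborel[OF assms] by (rule AE_not_in)

text \<open>If there were too few alternations, a product of linear factors would follow the sign of \<open>h\<close>,
  and its integral against \<open>h\<close> could vanish only for \<open>h = 0\<close>. This gives lists of length \<open>N\<close>
  starting with either sign; the one that starts further to the right is prolonged by the head of the
  other one. If \<open>h\<close> is negative somewhere to the left of \<open>l\<close>, such a point already prolongs a list that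
  starts with a positive value.\<close>

lemma orthogonal_imp_alternates:
  assumes ae: "AE x in lborel. x \<in> E"
    and left: "\<And>x. x < l \<Longrightarrow> h x \<le> 0"
    and orth: "\<And>cs. length cs < N \<Longrightarrow>
      has_bochner_integral lborel (\<lambda>x. h x * (\<Prod>c\<leftarrow>cs. c - x)) 0"
    and nz: "\<not> (AE x in lborel. h x = 0)"
  shows "\<exists>xs. alternates h xs \<and> set xs \<subseteq> E \<and> length xs = Suc N"
proof (cases N)
  case 0
  obtain x where "x \<in> E" "h x \<noteq> 0"
    using nz ae by (metis (mono_tags, lifting) AE_mp AE_I2)
  then show ?thesis using 0 by (intro exI[of _ "[x]"]) (auto simp: alternates_def)
next
  case (Suc K)
  have no_fit: False
    if s: "s \<noteq> 0" and cs: "length cs \<le> K"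
      and le: "\<And>x. x \<in> E \<Longrightarrow> s * h x * (\<Prod>c\<leftarrow>cs. c - x) \<le> 0" for s cs
  proof -
    let ?f = "\<lambda>x. - s * (h x * (\<Prod>c\<leftarrow>cs. c - x))"
    have "has_bochner_integral lborel (\<lambda>x. h x * (\<Prod>c\<leftarrow>cs. c - x)) 0"
      using cs Suc by (intro orth) auto
    then have hb: "has_bochner_integral lborel ?f 0"
      using has_bochner_integral_mult_right[of "- s"] by fastforce
    have pos: "AE x in lborel. 0 \<le> ?f x"
      using ae by eventually_elim (use le in \<open>fastforce simp: mult.assoc\<close>)
    have "AE x in lborel. ?f x = 0"
      using hb pos integral_nonneg_eq_0_iff_AE[of lborel ?f]
      by (simp add: has_bochner_integral_iff)
    moreover have "AE x in lborel. x \<notin> set cs" by (rule AE_in_cofinite) simp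
    ultimately have "AE x in lborel. h x = 0"
      by eventually_elim (use s in \<open>auto simp: prod_list_zero_iff\<close>)
    then show False using nz by simp
  qed
  \<comment> \<open>On the left of \<open>l\<close> the product is positive and \<open>s * h\<close> is nonpositive, so the roots found for
    \<open>E \<inter> {l..}\<close> serve for all of \<open>E\<close>.\<close>
  have right: "\<exists>xs. alternates h xs \<and> set xs \<subseteq> E \<inter> {l..} \<and> length xs = Suc K \<and> s * h (hd xs) > 0"
    if s: "s \<noteq> 0" and sl: "\<And>x. x \<in> E \<Longrightarrow> x < l \<Longrightarrow> s * h x \<le> 0" for s
  proof (rule ccontr)
    assume none: "\<not> ?thesis"
    obtain cs where cs: "length cs \<le> K" "\<forall>c\<in>set cs. l \<le> c"
      "\<forall>x\<in>E \<inter> {l..}. s * h x * (\<Prod>c\<leftarrow>cs. c - x) \<le> 0"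
      using sign_correcting_roots[of "E \<inter> {l..}" l h K s] none by (meson Int_lower2 not_less)
    have "s * h x * (\<Prod>c\<leftarrow>cs. c - x) \<le> 0" if "x \<in> E" for x
    proof (cases "x < l")
      case True
      then have "0 \<le> (\<Prod>c\<leftarrow>cs. c - x)" using cs(2) by (intro prod_list_nonneg) auto
      with sl[OF that True] show ?thesis by (rule mult_nonpos_nonneg)
    qed (use cs that in auto)
    then show False using no_fit s cs(1) by blast
  qed
  obtain xs where xs: "alternates h xs" "set xs \<subseteq> E \<inter> {l..}" "length xs = Suc K" "h (hd xs) > 0"
    using right[of 1] left by auto
  show ?thesis
  proof (cases "\<exists>x\<in>E. x < l \<and> h x < 0")
    case True
    then obtain x where x: "x \<in> E" "x < l" "h x < 0" by blast
    have "hd xs \<in> set xs" using xs by (intro hd_in_set) auto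
    then have "x < hd xs" using xs x by fastforce
    then have "alternates h (x # xs)"
      using xs x by (auto simp: alternates_Cons mult_less_0_iff)
    then show ?thesis using xs x Suc by (intro exI[of _ "x # xs"]) auto
  next
    case False
    then have "(-1) * h x \<le> 0" if "x \<in> E" "x < l" for x
      using that by force
    then obtain ys where ys: "alternates h ys" "set ys \<subseteq> E \<inter> {l..}" "length ys = Suc K"
        "h (hd ys) < 0"
      using right[of "-1"] by fastforce
    have mem: "hd xs \<in> set xs" "hd ys \<in> set ys" using xs ys by (auto intro!: hd_in_set)
    have "hd xs \<noteq> hd ys" using xs ys by auto
    then consider "hd xs < hd ys" | "hd ys < hd xs" by linarith
    then show ?thesis
    proof cases
      case 1
      then have "alternates h (hd xs # ys)"
        using xs ys by (auto simp: alternates_Cons mult_less_0_iff)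
      then show ?thesis using xs ys mem Suc by (intro exI[of _ "hd xs # ys"]) auto
    next
      case 2
      then have "alternates h (hd ys # xs)"
        using xs ys by (auto simp: alternates_Cons mult_less_0_iff)
      then show ?thesis using xs ys mem Suc by (intro exI[of _ "hd ys # xs"]) auto
    qed
  qed
qed

section \<open>Components of the level sets of the modified graph\<close>

text \<open>An intermediate value theorem. If there were no crossing, then near every point of the
  interval \<open>f\<close> would stay below \<open>y\<close> or above \<open>y\<close>, except perhaps at the point itself; these two
  open conditions would disconnect the interval.\<close>

lemma modified_graph_crossing:
  assumes mg: "has_modified_graph UNIV f" and uv: "u < v"
    and cont: "isCont f u" "isCont f v" and cross: "(f u - y) * (f v - y) < 0"
  shows "\<exists>x. u < x \<and> x < v \<and> (x, y) \<in> modified_graph UNIV f"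
proof (rule ccontr)
  assume none: "\<not> ?thesis"
  define U where "U = {x. eventually (\<lambda>z. f z < y) (at x)}"
  define V where "V = {x. eventually (\<lambda>z. f z > y) (at x)}"
  have op: "open {x. eventually P (at x)}" for P :: "real \<Rightarrow> bool"
  proof (subst open_subopen, safe)
    fix x assume "eventually P (at x)"
    then obtain T where T: "open T" "x \<in> T" "\<forall>z\<in>T. z \<noteq> x \<longrightarrow> P z"
      by (auto simp: eventually_at_topological)
    have "eventually P (at w)" if "w \<in> T" for w
    proof (cases "w = x")
      case True
      then show ?thesis using T by (auto simp: eventually_at_topological)
    next
      case False
      then show ?thesis
        using T that unfolding eventually_at_topological
        by (intro exI[of _ "T - {x}"]) (auto intro: open_delete)
    qed
    then show "\<exists>T. open T \<and> x \<in> T \<and> T \<subseteq> {x. eventually P (at x)}"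
      using T by blast
  qed
  have oU: "open U" and oV: "open V" unfolding U_def V_def by (rule op)+
  have disj: "U \<inter> V = {}"
  proof safe
    fix x assume "x \<in> U" "x \<in> V"
    then have "eventually (\<lambda>z. f z < y \<and> f z > y) (at x)"
      by (auto simp: U_def V_def eventually_conj_iff)
    then have "eventually (\<lambda>z. False) (at x)" by (rule eventually_mono) auto
    then show "x \<in> {}" by simp
  qed
  have ends: "(w \<in> U \<longleftrightarrow> f w < y) \<and> (w \<in> V \<longleftrightarrow> f w > y)" if w: "isCont f w" "f w \<noteq> y" for w
  proof -
    have "f w < y \<Longrightarrow> w \<in> U" "f w > y \<Longrightarrow> w \<in> V"
      using w(1) by (auto simp: U_def V_def isCont_def order_tendstoD)
    then show ?thesis using disj w(2) by (cases "f w < y") auto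
  qed
  have cover: "x \<in> U \<union> V" if x: "u < x" "x < v" for x
  proof -
    obtain l r where l: "((\<lambda>z. ereal (f z)) \<longlongrightarrow> l) (at_left x)"
      and r: "((\<lambda>z. ereal (f z)) \<longlongrightarrow> r) (at_right x)"
      using mg unfolding has_modified_graph_def Int_UNIV_left by blast
    have "left_limit UNIV f x = l" "right_limit UNIV f x = r"
      unfolding left_limit_def right_limit_def using l r
      by (auto intro!: tendsto_Lim simp: trivial_limit_at_left_real trivial_limit_at_right_real)
    then have "\<not> (min l r \<le> ereal y \<and> ereal y \<le> max l r)"
      using none x by (auto simp: modified_graph_def)
    then have "ereal y < l \<and> ereal y < r \<or> l < ereal y \<and> r < ereal y"
      by (auto simp: min_def max_def split: if_splits)
    then show ?thesis
    proof
      assume a: "ereal y < l \<and> ereal y < r"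
      have "eventually (\<lambda>z. y < f z) (at_left x)" "eventually (\<lambda>z. y < f z) (at_right x)"
        using order_tendstoD(1)[OF l, of "ereal y"] order_tendstoD(1)[OF r, of "ereal y"] a by auto
      then show ?thesis by (auto simp: V_def eventually_at_split)
    next
      assume a: "l < ereal y \<and> r < ereal y"
      have "eventually (\<lambda>z. f z < y) (at_left x)" "eventually (\<lambda>z. f z < y) (at_right x)"
        using order_tendstoD(2)[OF l, of "ereal y"] order_tendstoD(2)[OF r, of "ereal y"] a by auto
      then show ?thesis by (auto simp: U_def eventually_at_split)
    qed
  qed
  have "f u \<noteq> y" "f v \<noteq> y" using cross by auto
  note eu = ends[OF cont(1) this(1)] and ev = ends[OF cont(2) this(2)]
  have opp: "f u < y \<and> f v > y \<or> f u > y \<and> f v < y"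
    using cross by (auto simp: mult_less_0_iff)
  have "{u..v} \<subseteq> U \<union> V"
  proof
    fix x assume "x \<in> {u..v}"
    then consider "x = u" | "x = v" | "u < x" "x < v" by fastforce
    then show "x \<in> U \<union> V" using eu ev opp cover by cases auto
  qed
  moreover have "U \<inter> V \<inter> {u..v} = {}" using disj by auto
  ultimately have "U \<inter> {u..v} = {} \<or> V \<inter> {u..v} = {}"
    using connectedD[of "{u..v}" U V] oU oV by auto
  then show False using eu ev opp uv by (auto simp: disjoint_iff)
qed

text \<open>At a jump the value of \<open>f\<close> says nothing about the modified graph, hence the continuity.\<close>

lemma notin_modified_graph:
  assumes "isCont f x" "f x \<noteq> y"
  shows "(x, y) \<notin> modified_graph UNIV f"
proof -
  have c: "(f \<longlongrightarrow> f x) (at_left x)" "(f \<longlongrightarrow> f x) (at_right x)"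
    using assms(1) by (auto simp: isCont_def filterlim_at_split)
  have "left_limit UNIV f x = ereal (f x)" "right_limit UNIV f x = ereal (f x)"
    unfolding left_limit_def right_limit_def using c
    by (auto intro!: tendsto_Lim simp: trivial_limit_at_left_real trivial_limit_at_right_real)
  then show ?thesis using assms(2) by (auto simp: modified_graph_def)
qed

text \<open>Consecutive points of the list enclose a crossing, and the points themselves, off the level
  set, separate the crossings from each other.\<close>

lemma num_components_level_set_ge:
  assumes mg: "has_modified_graph UNIV f"
    and alt: "alternates (\<lambda>x. f x - y) xs" and cont: "\<forall>x\<in>set xs. isCont f x"
  shows "enat (length xs - 1) \<le> num_components {x. (x, y) \<in> modified_graph UNIV f}"
proof -
  define L where "L = {x. (x, y) \<in> modified_graph UNIV f}"
  define I where "I = {i. Suc i < length xs}"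
  have "\<exists>p::real. xs ! i < p \<and> p < xs ! Suc i \<and> p \<in> L" if "i \<in> I" for i
    using modified_graph_crossing[OF mg, of "xs ! i" "xs ! Suc i" y] alternates_nth[OF alt] that cont
    by (auto simp: I_def L_def)
  then obtain p where p: "\<And>i. i \<in> I \<Longrightarrow> xs ! i < p i \<and> p i < xs ! Suc i \<and> p i \<in> L"
    by metis
  have sep: "connected_component_set L (p i) \<noteq> connected_component_set L (p j)"
    if ij: "i \<in> I" "j \<in> I" "i < j" for i j
  proof
    assume eq: "connected_component_set L (p i) = connected_component_set L (p j)"
    have "p j \<in> connected_component_set L (p j)" using p[OF ij(2)] by auto
    then have "connected_component L (p i) (p j)" using eq by auto
    then have seg: "closed_segment (p i) (p j) \<subseteq> L" by (simp add: connected_component_real_iff)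
    have "xs ! Suc i \<le> xs ! j"
      using sorted_wrt_nth_less[OF sorted_alternates[OF alt], of "Suc i" j] ij
      by (cases "Suc i = j") (auto simp: I_def)
    then have "xs ! Suc i \<in> closed_segment (p i) (p j)"
      using p[OF ij(1)] p[OF ij(2)] by (auto simp: closed_segment_eq_real_ivl)
    moreover have "xs ! Suc i \<in> set xs" using ij by (auto simp: I_def)
    then have "xs ! Suc i \<notin> L"
      using notin_modified_graph[where f = f and x = "xs ! Suc i" and y = y] cont alt
      by (auto simp: L_def alternates_def)
    ultimately show False using seg by blast
  qed
  have inj: "inj_on (\<lambda>i. connected_component_set L (p i)) I"
    using sep by (intro inj_onI) (metis nat_neq_iff)
  have sub: "(\<lambda>i. connected_component_set L (p i)) ` I \<subseteq> components L"
    using p by (auto simp: components_def)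
  have I: "I = {..<length xs - 1}" by (auto simp: I_def)
  show ?thesis
  proof (cases "finite (components L)")
    case True
    then have "length xs - 1 \<le> card (components L)"
      using card_inj_on_le[OF inj sub] by (simp add: I)
    then show ?thesis using True by (simp add: num_components_def flip: L_def)
  qed (simp add: num_components_def flip: L_def)
qed

text \<open>A nowhere dense set of levels cannot contain a whole interval of levels.\<close>

lemma sup_num_components_ge:
  assumes mg: "has_modified_graph UNIV f" and S: "nowhere_dense S"
    and uv: "0 \<le> u" "u < v"
    and alt: "\<And>y. u < y \<Longrightarrow> y < v \<Longrightarrow> \<exists>xs. alternates (\<lambda>x. f x - y) xs \<and>
        (\<forall>x\<in>set xs. isCont f x) \<and> Suc k = length xs"
  shows "enat k \<le> (SUP y\<in>{y. 0 < y \<and> y \<notin> S}. num_components {x. (x, y) \<in> modified_graph UNIV f})"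
proof -
  have "\<not> {u<..<v} \<subseteq> S"
  proof
    assume "{u<..<v} \<subseteq> S"
    then have "{u<..<v} \<subseteq> interior (closure S)"
      by (intro interior_maximal) (use closure_subset in auto)
    then show False using S uv dense[OF uv(2)] by (auto simp: nowhere_dense_def)
  qed
  then obtain y where y: "u < y" "y < v" "y \<notin> S"
    unfolding subset_iff greaterThanLessThan_iff by blast
  then obtain xs where "alternates (\<lambda>x. f x - y) xs" "\<forall>x\<in>set xs. isCont f x" "Suc k = length xs"
    using alt by blast
  then have "enat k \<le> num_components {x. (x, y) \<in> modified_graph UNIV f}"
    using num_components_level_set_ge[OF mg, of y xs] by (metis diff_Suc_1)
  then show ?thesis
    using y uv by (intro SUP_upper2[of y]) auto
qed

section \<open>Integrals of rational functions over the real line\<close>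

lemma has_bochner_integral_line_FTC:
  fixes f F :: "real \<Rightarrow> 'a::euclidean_space"
  assumes "\<And>x. (F has_vector_derivative f x) (at x)" and "\<And>x. isCont f x"
    and "integrable lborel f" and "(F \<longlongrightarrow> A) at_bot" and "(F \<longlongrightarrow> B) at_top"
  shows "has_bochner_integral lborel f (B - A)"
proof -
  have "(LBINT x=-\<infinity>..\<infinity>. f x) = B - A"
    using assms
    by (intro interval_integral_FTC_integrable) (auto simp: ereal_tendsto_simps set_integrable_def)
  then show ?thesis
    using assms(3)
    by (simp add: has_bochner_integral_iff interval_lebesgue_integral_def set_lebesgue_integral_def)
qed

text \<open>An affine substitution turns the integrand into a multiple of \<open>1 / (1 + x\<^sup>2)\<close>.\<close>

lemma integrable_inverse_norm_square:
  fixes w :: complex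
  assumes "Im w \<noteq> 0"
  shows "integrable lborel (\<lambda>x::real. 1 / (cmod (of_real x - w))\<^sup>2)"
proof -
  have "integrable lborel (\<lambda>x::real. inverse (1 + x\<^sup>2))"
    using integrable_inverse_1_plus_square by (simp add: set_integrable_def)
  then have "integrable lborel (\<lambda>x. inverse (1 + (- Re w / Im w + (1 / Im w) * x)\<^sup>2))"
    by (rule lborel_integrable_real_affine) (use assms in auto)
  then have "integrable lborel (\<lambda>x. (1 / (Im w)\<^sup>2) * inverse (1 + (- Re w / Im w + (1 / Im w) * x)\<^sup>2))"
    by (rule integrable_mult_right)
  moreover have "(1 / (Im w)\<^sup>2) * inverse (1 + (- Re w / Im w + (1 / Im w) * x)\<^sup>2)
      = 1 / (cmod (of_real x - w))\<^sup>2" for x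
  proof -
    have "(Im w)\<^sup>2 * (1 + (- Re w / Im w + (1 / Im w) * x)\<^sup>2) = (x - Re w)\<^sup>2 + (Im w)\<^sup>2"
      using assms by (simp add: field_simps power2_eq_square)
    also have "\<dots> = (cmod (of_real x - w))\<^sup>2"
      by (simp add: cmod_power2)
    finally have "(Im w)\<^sup>2 * (1 + (- Re w / Im w + (1 / Im w) * x)\<^sup>2) = (cmod (of_real x - w))\<^sup>2" .
    moreover have "(1 / a) * inverse b = 1 / (a * b)" for a b :: real
      by (simp add: divide_inverse)
    ultimately show ?thesis by presburger
  qed
  ultimately show ?thesis by simp
qed

lemma integrable_inverse_pair:
  fixes w w' :: complex
  assumes "Im w \<noteq> 0" "Im w' \<noteq> 0"
  shows "integrable lborel (\<lambda>x::real. 1 / ((of_real x - w) * (of_real x - w')))"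
proof (rule Bochner_Integration.integrable_bound)
  show "integrable lborel (\<lambda>x::real. 1 / (cmod (of_real x - w))\<^sup>2 + 1 / (cmod (of_real x - w'))\<^sup>2)"
    using assms by (intro Bochner_Integration.integrable_add integrable_inverse_norm_square)
  have "norm (1 / ((of_real x - w) * (of_real x - w')))
      \<le> norm (1 / (cmod (of_real x - w))\<^sup>2 + 1 / (cmod (of_real x - w'))\<^sup>2)" for x :: real
  proof -
    define a b where "a = 1 / cmod (of_real x - w)" and "b = 1 / cmod (of_real x - w')"
    have ab: "0 \<le> a" "0 \<le> b" by (simp_all add: a_def b_def)
    have "2 * (a * b) \<le> a\<^sup>2 + b\<^sup>2" using sum_squares_bound[of a b] by simp
    then have "a * b \<le> a\<^sup>2 + b\<^sup>2" using ab mult_nonneg_nonneg[of a b] by linarith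
    then show ?thesis
      by (simp add: a_def b_def norm_mult norm_divide power_divide)
  qed
  then show "AE x in lborel. norm (1 / ((of_real x - w) * (of_real x - w')))
      \<le> norm (1 / (cmod (of_real x - w))\<^sup>2 + 1 / (cmod (of_real x - w'))\<^sup>2)" by simp
qed simp

lemma tendsto_inverse_of_real_minus:
  fixes w :: complex
  shows "((\<lambda>x::real. inverse (of_real x - w)) \<longlongrightarrow> 0) at_top"
    and "((\<lambda>x::real. inverse (of_real x - w)) \<longlongrightarrow> 0) at_bot"
proof -
  have top: "filterlim (\<lambda>x::real. complex_of_real x) at_infinity at_top"
    by (rule filterlim_of_real_at_infinity)
  have bot: "filterlim (\<lambda>x::real. complex_of_real x) at_infinity at_bot"
    by (intro filterlim_norm_at_top_imp_at_infinity filterlim_at_top_mono[OF filterlim_uminus_at_top_at_bot]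
        always_eventually) auto
  have *: "filterlim (\<lambda>x::real. of_real x - w) at_infinity F"
    if "filterlim (\<lambda>x::real. complex_of_real x) at_infinity F" for F
    using tendsto_add_filterlim_at_infinity[OF tendsto_const[of "- w"] that] by simp
  show "((\<lambda>x::real. inverse (of_real x - w)) \<longlongrightarrow> 0) at_top"
    "((\<lambda>x::real. inverse (of_real x - w)) \<longlongrightarrow> 0) at_bot"
    using filterlim_compose[OF tendsto_inverse_0 *[OF top]]
      filterlim_compose[OF tendsto_inverse_0 *[OF bot]] by simp_all
qed

lemma has_bochner_integral_inverse_power:
  fixes w :: complex
  assumes w: "Im w \<noteq> 0" and k: "2 \<le> k"
  shows "has_bochner_integral lborel (\<lambda>x::real. 1 / (of_real x - w) ^ k) 0"
proof -
  obtain j where j: "k = Suc (Suc j)" using k by (metis add_2_eq_Suc le_Suc_ex)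
  have nz: "of_real x - w \<noteq> 0" for x :: real using w by (auto simp: complex_eq_iff)
  define F where "F x = - (inverse (of_real x - w) ^ Suc j) / of_nat (Suc j)" for x :: real
  have deriv: "(F has_vector_derivative 1 / (of_real x - w) ^ k) (at x)" for x
  proof -
    define v where "v = inverse (of_real x - w)"
    have "((\<lambda>u. inverse (u - w)) has_field_derivative - (v * 1 * v)) (at (of_real x))"
      unfolding v_def using nz[of x] by (intro DERIV_inverse' derivative_eq_intros) auto
    then have d: "((\<lambda>u. - (inverse (u - w) ^ Suc j) / of_nat (Suc j)) has_field_derivative
        - (of_nat (Suc j) * (- (v * 1 * v) * v ^ (Suc j - Suc 0))) / of_nat (Suc j)) (at (of_real x))"
      unfolding v_def by (intro DERIV_cdivide DERIV_minus DERIV_power)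
    have "- (of_nat (Suc j) * (- (v * 1 * v) * v ^ (Suc j - Suc 0))) / of_nat (Suc j)
        = 1 / (of_real x - w) ^ k"
      by (simp add: j v_def power_one_over inverse_eq_divide del: of_nat_Suc)
    then show ?thesis
      using has_vector_derivative_real_field[OF d] unfolding F_def by (simp only:)
  qed
  have F0: "(F \<longlongrightarrow> - (0 ^ Suc j) / of_nat (Suc j)) at_top" "(F \<longlongrightarrow> - (0 ^ Suc j) / of_nat (Suc j)) at_bot"
    unfolding F_def
    by (intro tendsto_divide tendsto_minus tendsto_power tendsto_const tendsto_inverse_of_real_minus
        of_nat_neq_0)+
  have int: "integrable lborel (\<lambda>x::real. 1 / (of_real x - w) ^ k)"
  proof (rule Bochner_Integration.integrable_bound)
    show "integrable lborel (\<lambda>x::real. (1 / \<bar>Im w\<bar> ^ j) * (1 / (cmod (of_real x - w))\<^sup>2))"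
      using w by (intro integrable_mult_right integrable_inverse_norm_square)
    have "norm (1 / (of_real x - w) ^ k) \<le> norm ((1 / \<bar>Im w\<bar> ^ j) * (1 / (cmod (of_real x - w))\<^sup>2))"
      for x :: real
    proof -
      have "\<bar>Im w\<bar> \<le> cmod (of_real x - w)" using abs_Im_le_cmod[of "of_real x - w"] by simp
      then have "\<bar>Im w\<bar> ^ j \<le> cmod (of_real x - w) ^ j" by (intro power_mono) auto
      then have "\<bar>Im w\<bar> ^ j * (cmod (of_real x - w))\<^sup>2 \<le> cmod (of_real x - w) ^ k"
        using mult_right_mono[of "\<bar>Im w\<bar> ^ j" "cmod (of_real x - w) ^ j" "(cmod (of_real x - w))\<^sup>2"]
        by (simp add: j power2_eq_square mult_ac)
      then show ?thesis using w nz[of x]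
        by (simp add: norm_divide norm_power abs_mult frac_le)
    qed
    then show "AE x in lborel. norm (1 / (of_real x - w) ^ k)
        \<le> norm ((1 / \<bar>Im w\<bar> ^ j) * (1 / (cmod (of_real x - w))\<^sup>2))" by simp
  qed simp
  show ?thesis
  proof -
    have "isCont (\<lambda>x::real. 1 / (of_real x - w) ^ k) x" for x
      using nz by (intro continuous_intros) auto
    then show ?thesis
      using has_bochner_integral_line_FTC[OF deriv _ int F0(2) F0(1)] by simp
  qed
qed

text \<open>The asymptotics come from writing \<open>s * (x - w)\<close> as \<open>\<bar>x\<bar>\<close> times a factor that tends to
  \<open>s\<close> at \<open>\<infinity>\<close> and to \<open>- s\<close> at \<open>- \<infinity>\<close>.\<close>

lemma Ln_rotated_tendsto:
  fixes w s :: complex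
  assumes w: "Im w \<noteq> 0" and s: "s = \<i> \<or> s = - \<i>"
  shows "((\<lambda>x::real. Ln (s * (of_real x - w)) - of_real (ln x)) \<longlongrightarrow> Ln s) at_top"
    and "((\<lambda>x::real. Ln (s * (of_real x - w)) - of_real (ln (- x))) \<longlongrightarrow> Ln (- s)) at_bot"
proof -
  have nz: "of_real x - w \<noteq> 0" for x :: real using w by (auto simp: complex_eq_iff)
  have inv0: "((\<lambda>x::real. inverse (complex_of_real x)) \<longlongrightarrow> 0) at_top"
    "((\<lambda>x::real. inverse (complex_of_real x)) \<longlongrightarrow> 0) at_bot"
    using tendsto_inverse_of_real_minus[of 0] by simp_all
  have lim: "((\<lambda>x::real. Ln (t * (1 - w * inverse (of_real x)))) \<longlongrightarrow> Ln t) F"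
    if "((\<lambda>x::real. inverse (complex_of_real x)) \<longlongrightarrow> 0) F" "t \<notin> \<real>\<^sub>\<le>\<^sub>0" for t F
  proof -
    have "((\<lambda>x::real. t * (1 - w * inverse (of_real x))) \<longlongrightarrow> t * (1 - w * 0)) F"
      by (intro tendsto_intros that(1))
    then show ?thesis using that(2) by (intro tendsto_Ln) auto
  qed
  have eq: "Ln (s * (of_real x - w)) - of_real (ln \<bar>x\<bar>) = Ln (t * (1 - w * inverse (of_real x)))"
    if x: "x \<noteq> 0" and t: "t = of_real (sgn x) * s" for x :: real and t
  proof -
    define u where "u = t * (1 - w * inverse (of_real x))"
    have st: "s = of_real (sgn x) * t" unfolding t using x by (simp add: sgn_if)
    have prod: "s * (of_real x - w) = of_real \<bar>x\<bar> * u"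
    proof -
      have "of_real x - w = of_real x * (1 - w * inverse (of_real x))"
        using x by (simp add: field_simps)
      moreover have "complex_of_real \<bar>x\<bar> = of_real (sgn x) * of_real x"
        by (simp add: sgn_if)
      ultimately show ?thesis unfolding u_def st by simp
    qed
    have "s * (of_real x - w) \<noteq> 0" using nz[of x] s by auto
    then have "u \<noteq> 0" unfolding prod by simp
    then have "Ln (of_real \<bar>x\<bar> * u) = of_real (ln \<bar>x\<bar>) + Ln u"
      using x by (simp add: Ln_times_of_real Ln_of_real)
    then show ?thesis unfolding prod by (simp add: u_def)
  qed
  have s': "s \<notin> \<real>\<^sub>\<le>\<^sub>0" "- s \<notin> \<real>\<^sub>\<le>\<^sub>0"
    using s by (auto simp: complex_nonpos_Reals_iff)
  show "((\<lambda>x::real. Ln (s * (of_real x - w)) - of_real (ln x)) \<longlongrightarrow> Ln s) at_top"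
  proof (rule Lim_transform_eventually[OF lim[OF inv0(1) s'(1)]])
    show "\<forall>\<^sub>F x in at_top. Ln (s * (1 - w * inverse (of_real x))) = Ln (s * (of_real x - w)) - of_real (ln x)"
      using eventually_gt_at_top[of "0::real"]
    proof eventually_elim
      case (elim x)
      then show ?case using eq[of x s] by simp
    qed
  qed
  show "((\<lambda>x::real. Ln (s * (of_real x - w)) - of_real (ln (- x))) \<longlongrightarrow> Ln (- s)) at_bot"
  proof (rule Lim_transform_eventually[OF lim[OF inv0(2) s'(2)]])
    show "\<forall>\<^sub>F x in at_bot. Ln (- s * (1 - w * inverse (of_real x))) = Ln (s * (of_real x - w)) - of_real (ln (- x))"
      using eventually_gt_at_bot[of "0::real"]
    proof eventually_elim
      case (elim x)
      then show ?case using eq[of x "- s"] by simp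
    qed
  qed
qed

text \<open>The integrand is a difference of two terms \<open>1 / (x - u)\<close> divided by \<open>w - w'\<close>. Each of them has
  the primitive \<open>Ln (s * (x - u))\<close>, where \<open>s = \<plusminus>\<i>\<close> turns the line of all \<open>x - u\<close> into the right
  half-plane, away from the cut. The logarithmic growth cancels in the difference, and what is left is
  the total change of the argument, \<open>\<plusminus>\<pi>\<close> for each term.\<close>

lemma has_bochner_integral_inverse_pair:
  fixes w w' :: complex
  assumes w: "Im w \<noteq> 0" "Im w' \<noteq> 0" "w \<noteq> w'"
  shows "has_bochner_integral lborel (\<lambda>x::real. 1 / ((of_real x - w) * (of_real x - w')))
    (\<i> * pi * (sgn (Im w) - sgn (Im w')) / (w - w'))"
proof -
  define s where "s u = of_real (sgn (Im u)) * \<i>" for u :: complex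
  define F where "F x = (Ln (s w * (of_real x - w)) - Ln (s w' * (of_real x - w'))) / (w - w')" for x :: real
  have nz: "of_real x - u \<noteq> 0" if "Im u \<noteq> 0" for x :: real and u using that by (auto simp: complex_eq_iff)
  have s: "s u = \<i> \<or> s u = - \<i>" if "Im u \<noteq> 0" for u
    using that by (auto simp: s_def sgn_if)
  have Lns: "Ln (s u) = of_real (sgn (Im u) * pi / 2) * \<i>" "Ln (- s u) = of_real (- sgn (Im u) * pi / 2) * \<i>"
    if "Im u \<noteq> 0" for u
    using that by (auto simp: s_def sgn_if)
  have dLn: "((\<lambda>v. Ln (s u * (v - u))) has_field_derivative 1 / (of_real x - u)) (at (of_real x))"
    if u: "Im u \<noteq> 0" for u and x :: real
  proof -
    have "Re (s u * (of_real x - u)) = \<bar>Im u\<bar>" by (simp add: s_def sgn_if)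
    then have "s u * (of_real x - u) \<notin> \<real>\<^sub>\<le>\<^sub>0"
      using u by (auto simp: complex_nonpos_Reals_iff)
    then show ?thesis
      using s[OF u] nz[OF u, of x]
      by (auto intro!: derivative_eq_intros simp: field_simps)
  qed
  have deriv: "(F has_vector_derivative 1 / ((of_real x - w) * (of_real x - w'))) (at x)" for x
  proof -
    have d: "((\<lambda>v. (Ln (s w * (v - w)) - Ln (s w' * (v - w'))) / (w - w')) has_field_derivative
        (1 / (of_real x - w) - 1 / (of_real x - w')) / (w - w')) (at (of_real x))"
      using w by (intro DERIV_cdivide DERIV_diff dLn)
    have "(1 / (of_real x - w) - 1 / (of_real x - w')) / (w - w') = 1 / ((of_real x - w) * (of_real x - w'))"
      using nz[OF w(1), of x] nz[OF w(2), of x] w(3) by (simp add: divide_simps)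
    then show ?thesis
      using has_vector_derivative_real_field[OF d] unfolding F_def by (simp only:)
  qed
  have top: "(F \<longlongrightarrow> (Ln (s w) - Ln (s w')) / (w - w')) at_top"
    using tendsto_divide[OF tendsto_diff[OF Ln_rotated_tendsto(1)[OF w(1) s[OF w(1)]]
      Ln_rotated_tendsto(1)[OF w(2) s[OF w(2)]]] tendsto_const[of "w - w'"]] w(3)
    by (simp add: F_def[abs_def])
  have bot: "(F \<longlongrightarrow> (Ln (- s w) - Ln (- s w')) / (w - w')) at_bot"
    using tendsto_divide[OF tendsto_diff[OF Ln_rotated_tendsto(2)[OF w(1) s[OF w(1)]]
      Ln_rotated_tendsto(2)[OF w(2) s[OF w(2)]]] tendsto_const[of "w - w'"]] w(3)
    by (simp add: F_def[abs_def])
  have "has_bochner_integral lborel (\<lambda>x::real. 1 / ((of_real x - w) * (of_real x - w')))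
     ((Ln (s w) - Ln (s w')) / (w - w') - (Ln (- s w) - Ln (- s w')) / (w - w'))"
    using nz w
    by (intro has_bochner_integral_line_FTC[OF deriv _ _ bot top] integrable_inverse_pair)
      (auto intro!: continuous_intros)
  moreover have "(Ln (s w) - Ln (s w')) / (w - w') - (Ln (- s w) - Ln (- s w')) / (w - w')
      = \<i> * pi * (sgn (Im w) - sgn (Im w')) / (w - w')"
    using w by (simp only: Lns not_False_eq_True flip: diff_divide_distrib) (simp add: algebra_simps)
  ultimately show ?thesis by simp
qed

section \<open>Orthogonality from partial fractions\<close>

text \<open>Reduction to pure powers and pairs, by two identities: \<open>c - x = (c - w) - (x - w)\<close> removes a
  factor of the numerator, at the cost of at most one factor of the denominator; and the product of
  \<open>1 / (x - w)\<close> and \<open>1 / (x - w')\<close> is their difference divided by \<open>w - w'\<close>, which shortens a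
  denominator of at least three factors with two distinct roots. The degree condition guarantees that
  a single simple pole is never reached. The statement concerns products of linear factors because
  the test functions of \<open>orthogonal_imp_alternates\<close> are of this form.\<close>

lemma has_bochner_integral_partial_fractions:
  fixes g :: "real \<Rightarrow> real" and ws :: "complex multiset"
  assumes off: "\<And>x w. g x \<noteq> 0 \<Longrightarrow> w \<in># ws \<Longrightarrow> of_real x \<noteq> w"
    and pow: "\<And>w k. 2 \<le> k \<Longrightarrow> k \<le> count ws w \<Longrightarrow>
      has_bochner_integral M (\<lambda>x. of_real (g x) * (1 / (of_real x - w) ^ k)) 0"
    and pair: "\<And>w w'. \<lbrakk>w \<in># ws; w' \<in># ws; w \<noteq> w'\<rbrakk> \<Longrightarrow>
      has_bochner_integral M (\<lambda>x. of_real (g x) * (1 / ((of_real x - w) * (of_real x - w')))) 0"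
    and len: "length cs + 2 \<le> size ws"
  shows "has_bochner_integral M
    (\<lambda>x. of_real (g x) * ((\<Prod>c\<leftarrow>cs. of_real (c - x)) / (\<Prod>w\<in>#ws. of_real x - w))) 0"
proof -
  have unit: "has_bochner_integral M (\<lambda>x. of_real (g x) * (1 / (\<Prod>w\<in>#vs. of_real x - w))) 0"
    if "vs \<subseteq># ws" "2 \<le> size vs" for vs
    using that
  proof (induction "size vs" arbitrary: vs rule: less_induct)
    case less
    show ?case
    proof (cases "\<exists>w. vs = replicate_mset (size vs) w")
      case True
      then obtain w where w: "vs = replicate_mset (size vs) w" ..
      have "size vs \<le> count ws w"
        using less.prems(1) w by (metis count_replicate_mset mset_subset_eq_count)
      then show ?thesis using pow[OF less.prems(2)] by (subst w) simp
    next
      case False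
      obtain w where "w \<in># vs" using less.prems(2) by (metis multiset_nonemptyE not_numeral_le_zero size_empty)
      moreover obtain w' where "w' \<in># vs" "w' \<noteq> w"
        using False set_mset_subset_singletonD[of vs w] by auto
      ultimately have mem: "w \<in># vs" "w' \<in># vs - {#w#}" and ne: "w \<noteq> w'"
        by (auto simp: in_diff_count)
      define us where "us = vs - {#w#} - {#w'#}"
      have vs: "vs = add_mset w (add_mset w' us)" unfolding us_def by (metis mem insert_DiffM)
      have ws: "w \<in># ws" "w' \<in># ws" using less.prems(1) vs by (auto dest: mset_subset_eqD)
      show ?thesis
      proof (cases "us = {#}")
        case True
        then show ?thesis using pair[OF ws ne] by (simp add: vs)
      next
        case False
        have sz: "2 \<le> size (add_mset u us)" for u using False by (cases us) auto
        have sub: "add_mset w us \<subseteq># ws" "add_mset w' us \<subseteq># ws"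
          using less.prems(1) unfolding vs
          by (metis add_mset_commute mset_subset_eq_add_mset_cancel mset_subset_eq_insertD
              subset_mset.less_imp_le subset_mset.order_trans mset_subset_eq_add_right add_mset_add_single)+
        have "has_bochner_integral M (\<lambda>x. (1 / (w - w')) *
            (of_real (g x) * (1 / (\<Prod>u\<in>#add_mset w us. of_real x - u)) -
             of_real (g x) * (1 / (\<Prod>u\<in>#add_mset w' us. of_real x - u)))) ((1 / (w - w')) * (0 - 0))"
          using sub sz vs
          by (intro has_bochner_integral_mult_right has_bochner_integral_diff less.hyps) auto
        moreover have "(1 / (w - w')) *
            (of_real (g x) * (1 / (\<Prod>u\<in>#add_mset w us. of_real x - u)) -
             of_real (g x) * (1 / (\<Prod>u\<in>#add_mset w' us. of_real x - u)))
          = of_real (g x) * (1 / (\<Prod>u\<in>#vs. of_real x - u))" for x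
        proof (cases "g x = 0")
          case g: False
          have "of_real x - w \<noteq> 0" "of_real x - w' \<noteq> 0" using off[OF g] ws by auto
          moreover have "(\<Prod>u\<in>#us. of_real x - u) \<noteq> 0"
            using off[OF g] less.prems(1) vs by (auto simp: prod_mset_zero_iff dest!: mset_subset_eqD)
          moreover have id: "(1 / (B - A)) * (a * (1 / (A * P)) - a * (1 / (B * P))) = a * (1 / (A * (B * P)))"
            if "A \<noteq> 0" "B \<noteq> 0" "P \<noteq> 0" "B - A \<noteq> 0" for a A B P :: complex
          proof -
            have "a * (1 / (A * P)) - a * (1 / (B * P)) = (B - A) * (a * (1 / (A * (B * P))))"
              using that by (simp add: field_simps)
            then show ?thesis using that(4) by simp
          qed
          ultimately show ?thesis
            using ne id[of "of_real x - w" "of_real x - w'" "\<Prod>u\<in>#us. of_real x - u" "of_real (g x)"]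
            by (simp add: vs)
        qed simp
        ultimately show ?thesis by simp
      qed
    qed
  qed
  have "has_bochner_integral M
      (\<lambda>x. of_real (g x) * ((\<Prod>c\<leftarrow>cs. of_real (c - x)) / (\<Prod>w\<in>#vs. of_real x - w))) 0"
    if "vs \<subseteq># ws" "length cs + 2 \<le> size vs" for vs
    using that
  proof (induction cs arbitrary: vs)
    case Nil
    then show ?case using unit by simp
  next
    case (Cons c cs)
    obtain w where "w \<in># vs" using Cons.prems(2)
      by (metis add_is_0 le_0_eq multiset_nonemptyE size_empty zero_neq_numeral)
    then obtain us where vs: "vs = add_mset w us" by (metis insert_DiffM)
    have us: "us \<subseteq># ws" using Cons.prems(1) vs by (meson mset_subset_eq_insertD subset_mset.less_imp_le)
    have "has_bochner_integral M (\<lambda>x.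
        (of_real c - w) * (of_real (g x) * ((\<Prod>c\<leftarrow>cs. of_real (c - x)) / (\<Prod>w\<in>#vs. of_real x - w))) -
        of_real (g x) * ((\<Prod>c\<leftarrow>cs. of_real (c - x)) / (\<Prod>w\<in>#us. of_real x - w))) ((of_real c - w) * 0 - 0)"
      using Cons us vs by (intro has_bochner_integral_mult_right has_bochner_integral_diff Cons.IH) auto
    moreover have "(of_real c - w) * (of_real (g x) * ((\<Prod>c\<leftarrow>cs. of_real (c - x)) / (\<Prod>w\<in>#vs. of_real x - w))) -
        of_real (g x) * ((\<Prod>c\<leftarrow>cs. of_real (c - x)) / (\<Prod>w\<in>#us. of_real x - w))
      = of_real (g x) * ((\<Prod>c\<leftarrow>c # cs. of_real (c - x)) / (\<Prod>w\<in>#vs. of_real x - w))" for x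
    proof (cases "g x = 0")
      case g: False
      have "of_real x - w \<noteq> 0" using off[OF g] Cons.prems(1) vs by (auto dest!: mset_subset_eqD)
      moreover have "(\<Prod>u\<in>#us. of_real x - u) \<noteq> 0"
        using off[OF g] us by (auto simp: prod_mset_zero_iff dest!: mset_subset_eqD)
      ultimately show ?thesis by (simp add: vs field_simps)
    qed simp
    ultimately show ?case by simp
  qed
  from this[OF subset_mset.order_refl len] show ?thesis .
qed

lemma prod_list_of_real: "(\<Prod>x\<leftarrow>xs. complex_of_real (f x)) = of_real (\<Prod>x\<leftarrow>xs. f x)"
  by (induction xs) auto

text \<open>The two denominators of the main argument: conjugate pairs give a positive function on the line,
  and real roots give a function that changes sign only across a root.\<close>

lemma prod_mset_cnj_pairs:
  "(\<Prod>w\<in>#M + image_mset cnj M. of_real x - w) = of_real (\<Prod>w\<in>#M. (cmod (of_real x - w))\<^sup>2)"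
proof (induction M)
  case (add w M)
  have "of_real ((cmod (of_real x - w))\<^sup>2) = (of_real x - w) * (of_real x - cnj w)"
    using complex_norm_square[of "of_real x - w"] by simp
  with add show ?case by (simp add: mult_ac)
qed simp

lemma prod_mset_real_roots:
  assumes "\<And>w. w \<in># M \<Longrightarrow> Im w = 0"
  shows "(\<Prod>w\<in>#M. of_real x - w) = of_real (\<Prod>w\<in>#M. x - Re w)"
  using assms
proof (induction M)
  case (add w M)
  have "w = of_real (Re w)" using add.prems[of w] by (simp add: complex_eq_iff)
  then have "of_real x - w = of_real (x - Re w)" by (metis of_real_diff)
  with add show ?case by simp
qed simp

lemma root_between:
  fixes M :: "complex multiset"
  assumes "(\<Prod>w\<in>#M. u - Re w) * (\<Prod>w\<in>#M. v - Re w) < 0" and "u < v"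
  shows "\<exists>w\<in>#M. u < Re w \<and> Re w < v"
proof (rule ccontr)
  assume "\<not> ?thesis"
  then have "\<forall>w\<in>#M. 0 \<le> (u - Re w) * (v - Re w)"
    using assms(2) by (fastforce simp: zero_le_mult_iff)
  then have "0 \<le> (\<Prod>w\<in>#M. u - Re w) * (\<Prod>w\<in>#M. v - Re w)"
  proof (induction M)
    case (add w M)
    have "0 \<le> ((u - Re w) * (v - Re w)) * ((\<Prod>w\<in>#M. u - Re w) * (\<Prod>w\<in>#M. v - Re w))"
      by (rule mult_nonneg_nonneg) (use add in auto)
    then show ?case by (simp add: mult_ac)
  qed simp
  then show False using assms(1) by simp
qed

section \<open>Stieltjes transforms of compactly supported densities\<close>

locale compact_density =
  fixes \<rho> :: "real \<Rightarrow> real" and \<Gamma> :: "real set"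
  assumes integrable_density: "integrable lborel \<rho>"
    and nonneg: "0 \<le> \<rho> x"
    and compact: "compact \<Gamma>"
    and zero_off: "x \<notin> \<Gamma> \<Longrightarrow> \<rho> x = 0"
begin

definition G :: "complex \<Rightarrow> complex" where
  "G z = (LINT x|lborel. of_real (\<rho> x) / (z - of_real x))"

text \<open>Up to sign and an index shift, the Taylor coefficients of \<open>G\<close> at \<open>z\<close>.\<close>

definition moment :: "nat \<Rightarrow> complex \<Rightarrow> complex" where
  "moment j z = (LINT x|lborel. of_real (\<rho> x) * (1 / (z - of_real x) ^ j))"

lemma G_eq_moment: "G z = moment 1 z"
  by (simp add: G_def moment_def)

lemma measurable_density [measurable]: "\<rho> \<in> borel_measurable borel"
  using borel_measurable_integrable[OF integrable_density] by simp

lemma integrable_density_mult: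
  fixes r :: "real \<Rightarrow> complex"
  assumes "r \<in> borel_measurable borel" and "\<And>x. x \<in> \<Gamma> \<Longrightarrow> norm (r x) \<le> C"
  shows "integrable lborel (\<lambda>x. of_real (\<rho> x) * r x)"
    and "norm (LINT x|lborel. of_real (\<rho> x) * r x) \<le> C * (LINT x|lborel. \<rho> x)"
proof -
  have bd: "norm (of_real (\<rho> x) * r x) \<le> C * \<rho> x" for x
    using assms(2)[of x] nonneg[of x] zero_off[of x]
      mult_left_mono[of "norm (r x)" C "\<rho> x"]
    by (cases "x \<in> \<Gamma>") (auto simp: norm_mult mult.commute)
  have int: "integrable lborel (\<lambda>x. C * \<rho> x)"
    using integrable_density by simp
  show i: "integrable lborel (\<lambda>x. of_real (\<rho> x) * r x)"
  proof (rule Bochner_Integration.integrable_bound[OF int])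
    show "(\<lambda>x. of_real (\<rho> x) * r x) \<in> borel_measurable lborel"
      using assms(1) by measurable
    show "AE x in lborel. norm (of_real (\<rho> x) * r x) \<le> norm (C * \<rho> x)"
      by (rule AE_I2) (metis abs_ge_self bd order_trans real_norm_def)
  qed
  have "norm (LINT x|lborel. of_real (\<rho> x) * r x) \<le> (LINT x|lborel. C * \<rho> x)"
    using bd by (intro Bochner_Integration.integral_norm_bound_integral i int) auto
  then show "norm (LINT x|lborel. of_real (\<rho> x) * r x) \<le> C * (LINT x|lborel. \<rho> x)"
    by simp
qed

lemma gap:
  assumes "z \<notin> complex_of_real ` \<Gamma>"
  obtains d where "0 < d" "\<And>x. x \<in> \<Gamma> \<Longrightarrow> d \<le> cmod (z - of_real x)"
proof -
  have "compact (complex_of_real ` \<Gamma>)"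
    by (intro compact_continuous_image compact continuous_intros)
  then obtain d where "0 < d" "\<forall>u\<in>complex_of_real ` \<Gamma>. d \<le> dist z u"
    using separate_point_closed[of "complex_of_real ` \<Gamma>" z] assms compact_imp_closed by blast
  then show thesis using that[of d] by (auto simp: dist_norm)
qed

lemma integrable_moment:
  assumes "z \<notin> complex_of_real ` \<Gamma>"
  shows "integrable lborel (\<lambda>x. of_real (\<rho> x) * (1 / (z - of_real x) ^ j))"
proof -
  obtain d where d: "0 < d" "\<And>x. x \<in> \<Gamma> \<Longrightarrow> d \<le> cmod (z - of_real x)" using gap[OF assms] by blast
  show ?thesis
  proof (rule integrable_density_mult)
    fix x assume "x \<in> \<Gamma>"
    then have "d ^ j \<le> cmod (z - of_real x) ^ j" using d by (intro power_mono) auto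
    then show "norm (1 / (z - of_real x) ^ j) \<le> 1 / d ^ j"
      using d(1) by (simp add: norm_divide norm_power frac_le)
  qed measurable
qed

lemma cnj_moment: "moment j (cnj z) = cnj (moment j z)"
proof -
  have "cnj (moment j z) = (LINT x|lborel. cnj (of_real (\<rho> x) * (1 / (z - of_real x) ^ j)))"
    unfolding moment_def by (rule Bochner_Integration.integral_cnj[symmetric])
  then show ?thesis by (simp add: moment_def)
qed

lemma nonreal_notin: "Im z \<noteq> 0 \<Longrightarrow> z \<notin> complex_of_real ` \<Gamma>"
  by auto

text \<open>The finite geometric sum for \<open>1 / (w - x)\<close> in powers of \<open>(z - w) / (z - x)\<close> is integrated against
  \<open>\<rho>\<close>; its remainder is bounded because \<open>z\<close> and all nearby \<open>w\<close> keep a distance from \<open>\<Gamma>\<close>. This one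
  estimate gives both the holomorphy of \<open>G\<close> and the vanishing of moments at multiple solutions.\<close>

lemma taylor_bound:
  assumes "z \<notin> complex_of_real ` \<Gamma>"
  shows "\<exists>C r. 0 < r \<and> (\<forall>w\<in>ball z r. w \<notin> complex_of_real ` \<Gamma> \<and>
    cmod (G w - (\<Sum>j<k. (z - w) ^ j * moment (Suc j) z)) \<le> C * cmod (w - z) ^ k)"
proof -
  obtain d where d: "0 < d" "\<And>x. x \<in> \<Gamma> \<Longrightarrow> d \<le> cmod (z - of_real x)" using gap[OF assms] by blast
  have "w \<notin> complex_of_real ` \<Gamma> \<and> cmod (G w - (\<Sum>j<k. (z - w) ^ j * moment (Suc j) z))
      \<le> (1 / (d ^ k * (d / 2)) * (LINT x|lborel. \<rho> x)) * cmod (w - z) ^ k"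
    if w: "w \<in> ball z (d / 2)" for w
  proof
    have far: "d / 2 \<le> cmod (w - of_real x)" if "x \<in> \<Gamma>" for x
    proof -
      have "cmod (z - of_real x) \<le> cmod (z - w) + cmod (w - of_real x)"
        using norm_triangle_ineq[of "z - w" "w - of_real x"] by simp
      then show ?thesis using d(2)[OF that] w by (simp add: dist_norm)
    qed
    show wnot: "w \<notin> complex_of_real ` \<Gamma>" using far d(1) by fastforce
    let ?R = "\<lambda>x. 1 / ((z - of_real x) ^ k * (w - of_real x))"
    have rb: "norm (?R x) \<le> 1 / (d ^ k * (d / 2))" if "x \<in> \<Gamma>" for x
    proof -
      have "d ^ k \<le> cmod (z - of_real x) ^ k" using d that by (intro power_mono) auto
      then have "d ^ k * (d / 2) \<le> cmod (z - of_real x) ^ k * cmod (w - of_real x)"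
        using far[OF that] d by (intro mult_mono) auto
      then have "1 / (cmod (z - of_real x) ^ k * cmod (w - of_real x)) \<le> 1 / (d ^ k * (d / 2))"
        using d(1) by (intro frac_le) auto
      then show ?thesis by (simp add: norm_divide norm_mult norm_power)
    qed
    have mR: "?R \<in> borel_measurable borel" by measurable
    have intR: "integrable lborel (\<lambda>x. of_real (\<rho> x) * ?R x)"
      and bdR: "norm (LINT x|lborel. of_real (\<rho> x) * ?R x) \<le> 1 / (d ^ k * (d / 2)) * (LINT x|lborel. \<rho> x)"
      using integrable_density_mult[OF mR rb] by blast+
    have geo: "1 / (w - u) = (\<Sum>j<k. (z - w) ^ j * (1 / (z - u) ^ Suc j)) + (z - w) ^ k * (1 / ((z - u) ^ k * (w - u)))"
      if "z \<noteq> u" "w \<noteq> u" for u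
    proof (induction k)
      case (Suc k)
      have "1 / ((z - u) ^ k * (w - u)) = 1 / (z - u) ^ Suc k + (z - w) * (1 / ((z - u) ^ Suc k * (w - u)))"
        using that by (simp add: divide_simps)
      then have "(z - w) ^ k * (1 / ((z - u) ^ k * (w - u)))
          = (z - w) ^ k * (1 / (z - u) ^ Suc k) + (z - w) ^ Suc k * (1 / ((z - u) ^ Suc k * (w - u)))"
        by (simp add: algebra_simps)
      with Suc show ?case by simp
    qed simp
    have pt: "of_real (\<rho> x) / (w - of_real x) =
        (\<Sum>j<k. (z - w) ^ j * (of_real (\<rho> x) * (1 / (z - of_real x) ^ Suc j))) + (z - w) ^ k * (of_real (\<rho> x) * ?R x)"
      for x
    proof (cases "x \<in> \<Gamma>")
      case True
      then have ne: "z \<noteq> of_real x" "w \<noteq> of_real x" using assms wnot by auto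
      have "of_real (\<rho> x) / (w - of_real x) = of_real (\<rho> x) * (1 / (w - of_real x))" by simp
      also have "\<dots> = of_real (\<rho> x) * (\<Sum>j<k. (z - w) ^ j * (1 / (z - of_real x) ^ Suc j))
          + of_real (\<rho> x) * ((z - w) ^ k * ?R x)"
        by (subst geo[OF ne]) (rule distrib_left)
      finally show ?thesis by (simp only: sum_distrib_left mult.left_commute)
    qed (simp add: zero_off)
    have "has_bochner_integral lborel (\<lambda>x. of_real (\<rho> x) / (w - of_real x))
        ((\<Sum>j<k. (z - w) ^ j * moment (Suc j) z) + (z - w) ^ k * (LINT x|lborel. of_real (\<rho> x) * ?R x))"
      unfolding pt
      using integrable_moment[OF assms] intR
      by (intro has_bochner_integral_add has_bochner_integral_sum has_bochner_integral_mult_right)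
        (simp_all only: moment_def has_bochner_integral_iff)
    then have "G w = (\<Sum>j<k. (z - w) ^ j * moment (Suc j) z)
        + (z - w) ^ k * (LINT x|lborel. of_real (\<rho> x) * ?R x)"
      unfolding G_def by (rule has_bochner_integral_integral_eq)
    then have "cmod (G w - (\<Sum>j<k. (z - w) ^ j * moment (Suc j) z))
        = cmod (w - z) ^ k * norm (LINT x|lborel. of_real (\<rho> x) * ?R x)"
      by (simp add: norm_mult norm_power norm_minus_commute)
    also have "\<dots> \<le> cmod (w - z) ^ k * (1 / (d ^ k * (d / 2)) * (LINT x|lborel. \<rho> x))"
      using bdR by (intro mult_left_mono) auto
    finally show "cmod (G w - (\<Sum>j<k. (z - w) ^ j * moment (Suc j) z))
        \<le> (1 / (d ^ k * (d / 2)) * (LINT x|lborel. \<rho> x)) * cmod (w - z) ^ k"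
      by (simp add: mult.commute)
  qed
  then show ?thesis using half_gt_zero[OF d(1)] by blast
qed

lemma open_complement: "open (- complex_of_real ` \<Gamma>)"
  by (intro open_Compl compact_imp_closed compact_continuous_image compact continuous_intros)

lemma holomorphic_G: "G holomorphic_on - complex_of_real ` \<Gamma>"
proof -
  have "G field_differentiable at z" if "z \<in> - complex_of_real ` \<Gamma>" for z
  proof -
    have zn: "z \<notin> complex_of_real ` \<Gamma>" using that by simp
    obtain C r where r: "0 < r" and
      tb: "\<forall>w\<in>ball z r. w \<notin> complex_of_real ` \<Gamma> \<and>
        cmod (G w - (\<Sum>j<2. (z - w) ^ j * moment (Suc j) z)) \<le> C * cmod (w - z) ^ 2"
      using taylor_bound[OF zn, of 2] by blast
    have "((\<lambda>w. (G w - G z) / (w - z) - (- moment 2 z)) \<longlongrightarrow> 0) (at z)"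
    proof (rule Lim_null_comparison)
      show "((\<lambda>w. C * cmod (w - z)) \<longlongrightarrow> 0) (at z)"
        by (auto intro!: tendsto_eq_intros)
      have "norm ((G w - G z) / (w - z) - (- moment 2 z)) \<le> C * cmod (w - z)"
        if w: "w \<in> ball z r" "w \<noteq> z" for w
      proof -
        have "(G w - G z) / (w - z) - (- moment 2 z) = (G w - (\<Sum>j<2. (z - w) ^ j * moment (Suc j) z)) / (w - z)"
          using w by (simp add: numeral_2_eq_2 G_eq_moment field_simps)
        then show ?thesis using tb w
          by (simp add: norm_divide divide_le_eq power2_eq_square mult_ac)
      qed
      then show "\<forall>\<^sub>F w in at z. norm ((G w - G z) / (w - z) - (- moment 2 z)) \<le> C * cmod (w - z)"
        using r by (auto simp: eventually_at dist_commute intro!: exI[of _ r])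
    qed
    then have "((\<lambda>w. (G w - G z) / (w - z)) \<longlongrightarrow> - moment 2 z) (at z)"
      by (rule LIM_zero_cancel)
    then have "(G has_field_derivative - moment 2 z) (at z)"
      by (simp add: has_field_derivative_iff)
    then show ?thesis by (auto simp: field_differentiable_def)
  qed
  then show ?thesis by (simp add: holomorphic_on_open[OF open_complement] field_differentiable_def)
qed

end

section \<open>Multiple solutions and vanishing moments\<close>

lemma polynomial_small_imp_zero:
  fixes c :: "nat \<Rightarrow> complex"
  assumes r: "0 < r"
    and bd: "\<And>u. 0 < cmod u \<Longrightarrow> cmod u < r \<Longrightarrow> cmod (\<Sum>j<m. c j * u ^ j) \<le> C * cmod u ^ m"
    and j: "j < m"
  shows "c j = 0"
  using bd j
proof (induction m arbitrary: c j)
  case (Suc m)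
  have ev: "\<forall>\<^sub>F u in at 0. 0 < cmod u \<and> cmod u < r"
    using r by (auto simp: eventually_at dist_norm intro!: exI[of _ r])
  have "((\<lambda>u. cmod (\<Sum>j<Suc m. c j * u ^ j)) \<longlongrightarrow> cmod (\<Sum>j<Suc m. c j * 0 ^ j)) (at 0)"
    by (intro tendsto_intros)
  moreover have "((\<lambda>u::complex. C * cmod u ^ Suc m) \<longlongrightarrow> C * cmod 0 ^ Suc m) (at 0)"
    by (intro tendsto_intros)
  moreover have "\<forall>\<^sub>F u in at 0. cmod (\<Sum>j<Suc m. c j * u ^ j) \<le> C * cmod u ^ Suc m"
    using ev by eventually_elim (use Suc.prems(1) in blast)
  ultimately have "cmod (\<Sum>j<Suc m. c j * 0 ^ j) \<le> C * cmod 0 ^ Suc m"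
    by (intro tendsto_le[of "at (0::complex)"]) auto
  then have c0: "c 0 = 0"
    unfolding sum.lessThan_Suc_shift by simp
  have "cmod (\<Sum>j<m. c (Suc j) * u ^ j) \<le> C * cmod u ^ m" if "0 < cmod u" "cmod u < r" for u
  proof -
    have "(\<Sum>j<Suc m. c j * u ^ j) = u * (\<Sum>j<m. c (Suc j) * u ^ j)"
      by (subst sum.lessThan_Suc_shift) (simp add: c0 sum_distrib_left mult_ac)
    then have "cmod u * cmod (\<Sum>j<m. c (Suc j) * u ^ j) \<le> cmod u * (C * cmod u ^ m)"
      using Suc.prems(1)[OF that] by (simp add: norm_mult mult_ac)
    then show ?thesis using that(1) by simp
  qed
  then have "c (Suc i) = 0" if "i < m" for i
    using Suc.IH[of "\<lambda>j. c (Suc j)" i] that by blast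
  then show ?case using c0 Suc.prems(2) by (cases j) auto
qed simp

context compact_density
begin

text \<open>Both \<open>G w - \<zeta>\<close> and the Taylor remainder of order \<open>m\<close> are of size \<open>(w - z)\<^sup>m\<close>, where \<open>m\<close> is the
  multiplicity. So is then the Taylor polynomial of degree less than \<open>m\<close>, which must be zero.\<close>

lemma moment_eq_0_of_zorder:
  assumes z: "z \<notin> complex_of_real ` \<Gamma>" and sol: "G z = \<zeta>"
    and j: "2 \<le> j" "j \<le> nat (zorder (\<lambda>w. G w - \<zeta>) z)"
  shows "moment j z = 0"
proof -
  define m where "m = nat (zorder (\<lambda>w. G w - \<zeta>) z)"
  obtain C1 r1 where r1: "0 < r1" and
    tb: "\<forall>w\<in>ball z r1. w \<notin> complex_of_real ` \<Gamma> \<and>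
      cmod (G w - (\<Sum>j<m. (z - w) ^ j * moment (Suc j) z)) \<le> C1 * cmod (w - z) ^ m"
    using taylor_bound[OF z, of m] by blast
  have sub: "ball z r1 \<subseteq> - complex_of_real ` \<Gamma>" using tb by blast
  obtain C2 r2 where r2: "0 < r2" and
    bd2: "\<And>w. w \<in> ball z r2 \<Longrightarrow> cmod (G w - \<zeta>) \<le> C2 * cmod (w - z) ^ m"
  proof (cases "\<exists>w\<in>ball z r1. G w - \<zeta> \<noteq> 0")
    case True
    have "(\<lambda>w. G w - \<zeta>) holomorphic_on ball z r1"
      by (intro holomorphic_intros holomorphic_on_subset[OF holomorphic_G sub])
    then obtain r where r: "r > 0" "zor_poly (\<lambda>w. G w - \<zeta>) z holomorphic_on cball z r"
      "\<forall>w\<in>cball z r. G w - \<zeta> = zor_poly (\<lambda>w. G w - \<zeta>) z w * (w - z) ^ m"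
      using zorder_exist_zero[of "\<lambda>w. G w - \<zeta>" "ball z r1" z, OF _ open_ball connected_ball] True r1
      unfolding m_def centre_in_ball by blast
    have "bounded (zor_poly (\<lambda>w. G w - \<zeta>) z ` cball z r)"
      by (intro compact_imp_bounded compact_continuous_image holomorphic_on_imp_continuous_on r(2)) auto
    then obtain B where B: "\<forall>w\<in>cball z r. cmod (zor_poly (\<lambda>w. G w - \<zeta>) z w) \<le> B"
      unfolding bounded_iff by auto
    show thesis
    proof (rule that[OF r(1)])
      fix w assume "w \<in> ball z r"
      then show "cmod (G w - \<zeta>) \<le> B * cmod (w - z) ^ m"
        using r(3) B by (auto simp: norm_mult norm_power intro!: mult_right_mono)
    qed
  next
    \<comment> \<open>If \<open>G = \<zeta>\<close> near \<open>z\<close>, then the order is a default value, but \<open>G - \<zeta>\<close> vanishes to any order.\<close>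
    case False
    show thesis by (rule that[OF r1, of 0]) (use False in auto)
  qed
  define c where "c i = moment (Suc i) z - (if i = 0 then \<zeta> else 0)" for i
  have "c (j - 1) = 0"
  proof (rule polynomial_small_imp_zero)
    show "0 < min r1 r2" using r1 r2 by simp
    show "j - 1 < m" using j by (simp add: m_def)
    fix u :: complex assume u: "0 < cmod u" "cmod u < min r1 r2"
    have w: "z - u \<in> ball z r1" "z - u \<in> ball z r2" using u by (auto simp: dist_norm)
    obtain m' where m': "m = Suc m'" using j by (cases m) (auto simp: m_def)
    have "(\<Sum>i<m. c i * u ^ i) = (\<Sum>i<m. u ^ i * moment (Suc i) z) - \<zeta>"
      unfolding m' sum.lessThan_Suc_shift by (simp add: c_def mult.commute)
    then have "(\<Sum>i<m. c i * u ^ i) = (G (z - u) - \<zeta>) - (G (z - u) - (\<Sum>i<m. u ^ i * moment (Suc i) z))"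
      by simp
    then have "cmod (\<Sum>i<m. c i * u ^ i) = cmod ((G (z - u) - \<zeta>) - (G (z - u) - (\<Sum>i<m. u ^ i * moment (Suc i) z)))"
      by (rule arg_cong)
    also have "\<dots> \<le> cmod (G (z - u) - \<zeta>) + cmod (G (z - u) - (\<Sum>i<m. u ^ i * moment (Suc i) z))"
      by (rule norm_triangle_ineq4)
    also have "\<dots> \<le> (C2 + C1) * cmod u ^ m"
      using bspec[OF tb w(1)] bd2[OF w(2)] by (simp add: algebra_simps)
    finally show "cmod (\<Sum>i<m. c i * u ^ i) \<le> (C2 + C1) * cmod u ^ m" .
  qed
  then show ?thesis using j by (simp add: c_def split: if_splits)
qed

section \<open>Crossings forced by the solutions\<close>

lemma has_bochner_integral_moment:
  assumes "w \<notin> complex_of_real ` \<Gamma>"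
  shows "has_bochner_integral lborel (\<lambda>x. of_real (\<rho> x) * (1 / (of_real x - w) ^ j)) ((-1) ^ j * moment j w)"
proof -
  have "has_bochner_integral lborel (\<lambda>x. (-1) ^ j * (of_real (\<rho> x) * (1 / (w - of_real x) ^ j))) ((-1) ^ j * moment j w)"
    using integrable_moment[OF assms]
    by (intro has_bochner_integral_mult_right) (simp only: moment_def has_bochner_integral_iff)
  moreover have "(-1) ^ j * (of_real (\<rho> x) * (1 / (w - of_real x) ^ j)) = of_real (\<rho> x) * (1 / (of_real x - w) ^ j)" for x
  proof -
    have "(w - of_real x) ^ j = (-1) ^ j * (of_real x - w) ^ j"
      by (simp flip: power_mult_distrib)
    then show ?thesis by (cases "even j") auto
  qed
  ultimately show ?thesis by simp
qed

lemma has_bochner_integral_density_pair: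
  assumes w: "w \<notin> complex_of_real ` \<Gamma>" "w' \<notin> complex_of_real ` \<Gamma>" "w \<noteq> w'"
  shows "has_bochner_integral lborel (\<lambda>x. of_real (\<rho> x) * (1 / ((of_real x - w) * (of_real x - w'))))
    ((G w' - G w) / (w - w'))"
proof -
  have "has_bochner_integral lborel (\<lambda>x. (1 / (w - w')) *
      (of_real (\<rho> x) * (1 / (of_real x - w) ^ 1) - of_real (\<rho> x) * (1 / (of_real x - w') ^ 1)))
      ((1 / (w - w')) * ((-1) ^ 1 * moment 1 w - (-1) ^ 1 * moment 1 w'))"
    by (intro has_bochner_integral_mult_right has_bochner_integral_diff has_bochner_integral_moment w)
  moreover have "(1 / (w - w')) *
      (of_real (\<rho> x) * (1 / (of_real x - w) ^ 1) - of_real (\<rho> x) * (1 / (of_real x - w') ^ 1))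
    = of_real (\<rho> x) * (1 / ((of_real x - w) * (of_real x - w')))" for x
  proof (cases "x \<in> \<Gamma>")
    case True
    then have "of_real x - w \<noteq> 0" "of_real x - w' \<noteq> 0" using w by auto
    then have eq: "1 / (of_real x - w) - 1 / (of_real x - w') = (w - w') * (1 / ((of_real x - w) * (of_real x - w')))"
      by (simp add: field_simps)
    show ?thesis
      unfolding power_one_right right_diff_distrib[symmetric] eq using w(3) by simp
  qed (simp add: zero_off)
  moreover have "(1 / (w - w')) * ((-1) ^ 1 * moment 1 w - (-1) ^ 1 * moment 1 w') = (G w' - G w) / (w - w')"
    by (simp add: G_eq_moment)
  ultimately show ?thesis by (simp only:)
qed

lemma G_cnj: "G (cnj z) = cnj (G z)"
  by (simp add: G_eq_moment cnj_moment)

text \<open>\<open>Im (G z) = - Im z * (\<integral> \<rho> x / \<bar>z - x\<bar>\<^sup>2)\<close>, and the integral is positive.\<close>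

lemma Im_G_sign:
  assumes nz: "\<not> (AE x in lborel. \<rho> x = 0)" and z: "Im z \<noteq> 0"
  shows "Im (G z) * Im z < 0"
proof -
  have nr: "z - of_real x \<noteq> 0" for x :: real using z by (auto simp: complex_eq_iff)
  let ?h = "\<lambda>x. \<rho> x / (cmod (z - of_real x))\<^sup>2"
  have Im: "Im (of_real (\<rho> x) * (1 / (z - of_real x) ^ 1)) = - Im z * ?h x" for x
    by (simp add: Im_divide cmod_power2)
  have hb: "has_bochner_integral lborel (\<lambda>x. Im (of_real (\<rho> x) * (1 / (z - of_real x) ^ 1))) (Im (G z))"
    using integrable_moment[OF nonreal_notin[OF z], of 1]
    by (intro has_bochner_integral_Im) (simp only: G_eq_moment moment_def has_bochner_integral_iff)
  then have "has_bochner_integral lborel (\<lambda>x. (- 1 / Im z) * (- Im z * ?h x)) ((- 1 / Im z) * Im (G z))"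
    unfolding Im by (intro has_bochner_integral_mult_right)
  then have hb': "has_bochner_integral lborel ?h (- Im (G z) / Im z)"
    using z by simp
  have "- Im (G z) / Im z \<noteq> 0"
  proof
    assume "- Im (G z) / Im z = 0"
    then have "AE x in lborel. ?h x = 0"
      using hb' nonneg integral_nonneg_eq_0_iff_AE[of lborel ?h] by (simp add: has_bochner_integral_iff)
    then have "AE x in lborel. \<rho> x = 0" by eventually_elim (use nr in auto)
    then show False using nz by simp
  qed
  moreover have "0 \<le> - Im (G z) / Im z"
    using has_bochner_integral_integral_eq[OF hb'] Bochner_Integration.integral_nonneg[of lborel ?h] nonneg
    by (metis divide_nonneg_nonneg zero_le_power2)
  ultimately have "Im (G z) / Im z < 0" by (simp add: less_le)
  then show ?thesis by (auto simp: divide_less_0_iff mult_less_0_iff)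
qed

lemma support_bounds: obtains l r where "\<Gamma> \<subseteq> {l<..<r}"
proof -
  obtain B where "\<forall>x\<in>\<Gamma>. norm x \<le> B"
    using compact_imp_bounded[OF compact] unfolding bounded_iff by auto
  then have "\<Gamma> \<subseteq> {- \<bar>B\<bar> - 1<..<\<bar>B\<bar> + 1}" by force
  then show thesis by (rule that)
qed

lemma isCont_off: "x \<notin> \<Gamma> \<Longrightarrow> isCont \<rho> x"
proof -
  assume x: "x \<notin> \<Gamma>"
  have op: "open (- \<Gamma>)" by (intro open_Compl compact_imp_closed compact)
  have "continuous_on (- \<Gamma>) \<rho>"
    by (subst continuous_on_cong[OF refl, of _ \<rho> "\<lambda>_. 0"]) (auto simp: zero_off)
  then show ?thesis using continuous_on_eq_continuous_at[OF op] x by blast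
qed

text \<open>The orthogonality argument for \<open>\<rho> - y\<close> with the solutions and their conjugates as poles. The
  level \<open>y\<close> is such that subtracting it cancels the imaginary part of the transform at every pole.\<close>

lemma nonreal_alternates:
  assumes nz: "\<not> (AE x in lborel. \<rho> x = 0)" and \<zeta>: "Im \<zeta> \<noteq> 0"
    and ne: "ws \<noteq> {#}" and sol: "\<And>w. w \<in># ws \<Longrightarrow> G w = \<zeta>"
    and mom: "\<And>w j. 2 \<le> j \<Longrightarrow> j \<le> count ws w \<Longrightarrow> moment j w = 0"
    and E: "AE x in lborel. x \<in> E"
  shows "\<exists>xs. alternates (\<lambda>x. \<rho> x - \<bar>Im \<zeta>\<bar> / pi) xs \<and> set xs \<subseteq> E \<and> length xs = 2 * size ws"
proof -
  define y where "y = \<bar>Im \<zeta>\<bar> / pi"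
  have y: "0 < y" using \<zeta> by (simp add: y_def)
  define vs where "vs = ws + image_mset cnj ws"
  have side: "Im w * Im \<zeta> < 0" if w: "w \<in># ws" for w
  proof -
    have "Im w \<noteq> 0"
    proof
      assume "Im w = 0"
      then have "cnj w = w" by (simp add: complex_eq_iff)
      then have "Im (G w) = 0" using G_cnj[of w] by (metis Im_complex_of_real Reals_cnj_iff complex_is_Real_iff)
      then show False using sol[OF w] \<zeta> by simp
    qed
    then show ?thesis using Im_G_sign[OF nz, of w] sol[OF w] by (simp add: mult.commute)
  qed
  have vs_nr: "Im w \<noteq> 0" if "w \<in># vs" for w
    using that side by (fastforce simp: vs_def)
  have vs_G: "G w = Re \<zeta> - \<i> * pi * y * sgn (Im w)" if w: "w \<in># vs" for w
  proof -
    have base: "G u = Re \<zeta> - \<i> * pi * y * sgn (Im u)" if "u \<in># ws" for u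
      using sol[OF that] side[OF that] by (auto simp: complex_eq_iff y_def sgn_if mult_less_0_iff)
    show ?thesis
    proof (cases "w \<in># ws")
      case False
      then obtain u where u: "u \<in># ws" "w = cnj u" using w by (auto simp: vs_def)
      then show ?thesis using base[OF u(1)] by (simp add: G_cnj sgn_minus)
    qed (rule base)
  qed
  have vs_mom: "moment j w = 0" if j: "2 \<le> j" "j \<le> count vs w" for j w
  proof -
    have "count (image_mset cnj M) (cnj v) = count M v" for M v
      by (induction M) auto
    from this[of ws "cnj w"] have c: "count vs w = count ws w + count ws (cnj w)"
      by (simp add: vs_def)
    show ?thesis
    proof (cases "w \<in># ws")
      case True
      then have "cnj w \<notin># ws" using side[of w] side[of "cnj w"] by auto
      then have "count ws (cnj w) = 0" by (simp add: not_in_iff)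
      then show ?thesis using mom j c by simp
    next
      case False
      then have "count ws w = 0" by (simp add: not_in_iff)
      then have "moment j (cnj w) = 0" using mom j c by simp
      then show ?thesis by (simp add: cnj_moment)
    qed
  qed
  define Q where "Q x = (\<Prod>w\<in>#ws. (cmod (of_real x - w))\<^sup>2)" for x :: real
  have Q: "0 < Q x" for x
  proof -
    have "\<forall>w\<in>#ws. of_real x - w \<noteq> 0" using side by force
    then show ?thesis unfolding Q_def by (induction ws) auto
  qed
  define h where "h x = (\<rho> x - y) / Q x" for x
  obtain l r where lr: "\<Gamma> \<subseteq> {l<..<r}" by (rule support_bounds)
  have low: "h x < 0" if "x < l" for x
  proof -
    have "\<rho> x = 0" using lr that by (intro zero_off) auto
    then show ?thesis using y Q[of x] by (simp add: h_def divide_neg_pos)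
  qed
  have h_nz: "\<not> (AE x in lborel. h x = 0)"
  proof
    assume "AE x in lborel. h x = 0"
    then have "AE x in lborel. x \<notin> {l - 1<..<l}" by eventually_elim (use low in force)
    then have "{l - 1<..<l} \<in> null_sets lborel" by (subst AE_iff_null_sets) auto
    then show False by (simp add: null_sets_def)
  qed
  have orth: "has_bochner_integral lborel (\<lambda>x. h x * (\<Prod>c\<leftarrow>cs. c - x)) 0"
    if cs: "length cs < 2 * size ws - 1" for cs
  proof -
    have "has_bochner_integral lborel (\<lambda>x. of_real (\<rho> x - y) *
        ((\<Prod>c\<leftarrow>cs. of_real (c - x)) / (\<Prod>w\<in>#vs. of_real x - w))) 0"
    proof (rule has_bochner_integral_partial_fractions)
      fix x w assume "w \<in># vs"
      then show "of_real x \<noteq> w" using vs_nr[of w] by auto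
    next
      fix w and k :: nat assume k: "2 \<le> k" "k \<le> count vs w"
      then have w: "Im w \<noteq> 0" by (intro vs_nr) (simp flip: count_greater_zero_iff)
      have "has_bochner_integral lborel (\<lambda>x. of_real (\<rho> x) * (1 / (of_real x - w) ^ k) -
          of_real y * (1 / (of_real x - w) ^ k)) ((-1) ^ k * moment k w - of_real y * 0)"
        by (intro has_bochner_integral_diff has_bochner_integral_mult_right has_bochner_integral_moment
            has_bochner_integral_inverse_power nonreal_notin w k)
      then show "has_bochner_integral lborel (\<lambda>x. of_real (\<rho> x - y) * (1 / (of_real x - w) ^ k)) 0"
        using vs_mom[OF k] by (simp add: left_diff_distrib diff_divide_distrib)
    next
      fix w w' assume w: "w \<in># vs" "w' \<in># vs" "w \<noteq> w'"
      have "has_bochner_integral lborel (\<lambda>x. of_real (\<rho> x) * (1 / ((of_real x - w) * (of_real x - w'))) -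
          of_real y * (1 / ((of_real x - w) * (of_real x - w'))))
        ((G w' - G w) / (w - w') - of_real y * (\<i> * pi * (sgn (Im w) - sgn (Im w')) / (w - w')))"
        using vs_nr w
        by (intro has_bochner_integral_diff has_bochner_integral_mult_right has_bochner_integral_density_pair
            has_bochner_integral_inverse_pair nonreal_notin) auto
      moreover have "(G w' - G w) / (w - w') - of_real y * (\<i> * pi * (sgn (Im w) - sgn (Im w')) / (w - w')) = 0"
        unfolding vs_G[OF w(1)] vs_G[OF w(2)] using w(3) by (simp add: field_simps)
      ultimately show "has_bochner_integral lborel
          (\<lambda>x. of_real (\<rho> x - y) * (1 / ((of_real x - w) * (of_real x - w')))) 0"
        by (simp add: left_diff_distrib diff_divide_distrib)
    next
      show "length cs + 2 \<le> size vs" using cs by (simp add: vs_def)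
    qed
    then have "has_bochner_integral lborel (\<lambda>x. Re (of_real (\<rho> x - y) *
        ((\<Prod>c\<leftarrow>cs. of_real (c - x)) / (\<Prod>w\<in>#vs. of_real x - w)))) (Re 0)"
      by (rule has_bochner_integral_Re)
    moreover have "Re (of_real (\<rho> x - y) * ((\<Prod>c\<leftarrow>cs. of_real (c - x)) / (\<Prod>w\<in>#vs. of_real x - w)))
        = h x * (\<Prod>c\<leftarrow>cs. c - x)" for x
      unfolding vs_def prod_mset_cnj_pairs prod_list_of_real h_def Q_def
      by (simp flip: of_real_divide of_real_mult of_real_diff)
    ultimately show ?thesis by simp
  qed
  have "\<exists>xs. alternates h xs \<and> set xs \<subseteq> E \<and> length xs = Suc (2 * size ws - 1)"
    using low by (intro orthogonal_imp_alternates[OF E _ orth h_nz]) (auto intro: less_imp_le)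
  then obtain xs where xs: "alternates h xs" "set xs \<subseteq> E" "length xs = Suc (2 * size ws - 1)" by blast
  have "alternates (\<lambda>x. \<rho> x - y) xs"
    by (rule alternates_cong_sgn[OF xs(1)]) (simp add: h_def sgn_divide Q)
  then show ?thesis using xs ne by (intro exI[of _ xs]) (auto simp: y_def nonempty_has_size)
qed

text \<open>The orthogonality argument for \<open>\<rho>\<close> itself: the solutions are real, so that
  they are their own conjugates and enter once. The sign changes of \<open>\<rho> / Q\<close> are those of \<open>Q\<close>, and
  a root of \<open>Q\<close> is a point off \<open>\<Gamma>\<close>.\<close>

lemma real_alternates:
  assumes nz: "\<not> (AE x in lborel. \<rho> x = 0)"
    and ne: "ws \<noteq> {#}" and off: "\<And>w. w \<in># ws \<Longrightarrow> w \<notin> complex_of_real ` \<Gamma>"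
    and re: "\<And>w. w \<in># ws \<Longrightarrow> Im w = 0"
    and sol: "\<And>w. w \<in># ws \<Longrightarrow> G w = \<zeta>"
    and mom: "\<And>w j. 2 \<le> j \<Longrightarrow> j \<le> count ws w \<Longrightarrow> moment j w = 0"
    and E: "AE x in lborel. x \<in> E"
  shows "\<exists>xs. successively (\<lambda>u v. \<exists>z. u < z \<and> z < v \<and> z \<in> - \<Gamma>) xs \<and> (\<forall>x\<in>set xs. 0 < \<rho> x) \<and>
    set xs \<subseteq> E \<and> length xs = size ws"
proof -
  define Q where "Q x = (\<Prod>w\<in>#ws. x - Re w)" for x :: real
  have Re_off: "Re w \<notin> \<Gamma>" if "w \<in># ws" for w
  proof
    assume "Re w \<in> \<Gamma>"
    moreover have "w = of_real (Re w)" using re[OF that] by (simp add: complex_eq_iff)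
    ultimately show False using off[OF that] by (metis imageI)
  qed
  define h where "h x = \<rho> x / Q x" for x
  obtain l r where lr: "\<Gamma> \<subseteq> {l<..<r}" by (rule support_bounds)
  have low: "h x \<le> 0" if "x < l" for x
  proof -
    have "\<rho> x = 0" using lr that by (intro zero_off) auto
    then show ?thesis by (simp add: h_def)
  qed
  have h0: "\<rho> x = 0" if "h x = 0" for x
  proof (cases "Q x = 0")
    case True
    then obtain w where "w \<in># ws" "x = Re w" by (auto simp: Q_def prod_mset_zero_iff)
    then show ?thesis using Re_off zero_off by blast
  qed (use that in \<open>simp add: h_def\<close>)
  have h_nz: "\<not> (AE x in lborel. h x = 0)"
    using nz h0 by (metis (mono_tags, lifting) eventually_mono)
  have orth: "has_bochner_integral lborel (\<lambda>x. h x * (\<Prod>c\<leftarrow>cs. c - x)) 0"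
    if cs: "length cs < size ws - 1" for cs
  proof -
    have "has_bochner_integral lborel (\<lambda>x. of_real (\<rho> x) *
        ((\<Prod>c\<leftarrow>cs. of_real (c - x)) / (\<Prod>w\<in>#ws. of_real x - w))) 0"
    proof (rule has_bochner_integral_partial_fractions)
      fix x w assume "\<rho> x \<noteq> 0" "w \<in># ws"
      then show "of_real x \<noteq> w" using off zero_off by blast
    next
      fix w and k :: nat assume k: "2 \<le> k" "k \<le> count ws w"
      then have w: "w \<in># ws" by (simp flip: count_greater_zero_iff)
      show "has_bochner_integral lborel (\<lambda>x. of_real (\<rho> x) * (1 / (of_real x - w) ^ k)) 0"
        using has_bochner_integral_moment[OF off[OF w], of k] mom[OF k] by simp
    next
      fix w w' assume w: "w \<in># ws" "w' \<in># ws" "w \<noteq> w'"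
      show "has_bochner_integral lborel
          (\<lambda>x. of_real (\<rho> x) * (1 / ((of_real x - w) * (of_real x - w')))) 0"
        using has_bochner_integral_density_pair[OF off[OF w(1)] off[OF w(2)] w(3)] sol w by simp
    next
      show "length cs + 2 \<le> size ws" using cs by simp
    qed
    then have "has_bochner_integral lborel (\<lambda>x. Re (of_real (\<rho> x) *
        ((\<Prod>c\<leftarrow>cs. of_real (c - x)) / (\<Prod>w\<in>#ws. of_real x - w)))) (Re 0)"
      by (rule has_bochner_integral_Re)
    moreover have "Re (of_real (\<rho> x) * ((\<Prod>c\<leftarrow>cs. of_real (c - x)) / (\<Prod>w\<in>#ws. of_real x - w)))
        = h x * (\<Prod>c\<leftarrow>cs. c - x)" for x
    proof -
      have "(\<Prod>w\<in>#ws. of_real x - w) = of_real (Q x)"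
        unfolding Q_def by (rule prod_mset_real_roots[OF re])
      then show ?thesis
        unfolding prod_list_of_real h_def by (simp flip: of_real_divide of_real_mult of_real_diff)
    qed
    ultimately show ?thesis by simp
  qed
  have "\<exists>xs. alternates h xs \<and> set xs \<subseteq> E \<and> length xs = Suc (size ws - 1)"
    using low by (intro orthogonal_imp_alternates[OF E _ orth h_nz])
  then obtain xs where xs: "alternates h xs" "set xs \<subseteq> E" "length xs = Suc (size ws - 1)" by blast
  have pos: "0 < \<rho> x" if "x \<in> set xs" for x
  proof -
    have "h x \<noteq> 0" using xs(1) that by (auto simp: alternates_def)
    then show ?thesis using nonneg[of x] by (auto simp: h_def less_le)
  qed
  have "successively (\<lambda>u v. u < v \<and> h u * h v < 0) xs"
    using xs(1) by (simp add: alternates_def)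
  then have "successively (\<lambda>u v. \<exists>z. u < z \<and> z < v \<and> z \<in> - \<Gamma>) xs"
  proof (rule successively_mono)
    fix u v assume uv: "u \<in> set xs" "v \<in> set xs" "u < v \<and> h u * h v < 0"
    have "(\<rho> u * \<rho> v) / (Q u * Q v) < 0" using uv(3) by (simp add: h_def)
    then have "Q u * Q v < 0"
      using mult_pos_pos[OF pos[OF uv(1)] pos[OF uv(2)]] by (auto simp: divide_less_0_iff)
    then obtain w where "w \<in># ws" "u < Re w" "Re w < v"
      unfolding Q_def using root_between uv(3) by blast
    then show "\<exists>z. u < z \<and> z < v \<and> z \<in> - \<Gamma>" using Re_off by blast
  qed
  then show ?thesis using xs pos ne by (intro exI[of _ xs]) (auto simp: nonempty_has_size)
qed

text \<open>In the nonreal case one more point, far to the left or to the right, raises the number of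
  sign changes from \<open>2 m - 1\<close> to \<open>2 m\<close>: the list has even length, so exactly one of its ends is
  high. In the real case every positive level below all the high points is crossed \<open>2 m\<close> times.\<close>

lemma twice_size_le_sup:
  assumes nz: "\<not> (AE x in lborel. \<rho> x = 0)" and mg: "has_modified_graph UNIV \<rho>"
    and S: "nowhere_dense S" and off: "\<And>w. w \<in># ws \<Longrightarrow> w \<notin> complex_of_real ` \<Gamma>"
    and sol: "\<And>w. w \<in># ws \<Longrightarrow> G w = \<zeta>"
    and mom: "\<And>w j. 2 \<le> j \<Longrightarrow> j \<le> count ws w \<Longrightarrow> moment j w = 0"
  shows "enat (2 * size ws) \<le>
    (SUP y\<in>{y. 0 < y \<and> y \<notin> S}. num_components {x. (x, y) \<in> modified_graph UNIV \<rho>})"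
proof (cases "ws = {#}")
  case True
  then show ?thesis by (simp flip: zero_enat_def)
next
  case ne: False
  define E where "E = {x. isCont \<rho> x}"
  have "finite {x. \<not> isCont \<rho> x}" using mg by (simp add: has_modified_graph_def)
  from AE_in_cofinite[OF this] have E: "AE x in lborel. x \<in> E" by (simp add: E_def)
  obtain l r where lr: "\<Gamma> \<subseteq> {l<..<r}" by (rule support_bounds)
  then have lr_off: "l \<notin> \<Gamma>" "r \<notin> \<Gamma>" by auto
  have pos_in: "l < x \<and> x < r" if "\<rho> x > 0" for x
    using that lr zero_off[of x] by (cases "x \<in> \<Gamma>") auto
  show ?thesis
  proof (cases "Im \<zeta> = 0")
    case False
    define y where "y = \<bar>Im \<zeta>\<bar> / pi"
    have y: "0 < y" using False by (simp add: y_def)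
    obtain xs where xs: "alternates (\<lambda>x. \<rho> x - y) xs" "set xs \<subseteq> E" "length xs = 2 * size ws"
      using nonreal_alternates[OF nz False ne sol mom E] unfolding y_def by blast
    have xne: "xs \<noteq> []" using xs(3) ne by auto
    have opp: "(\<rho> (hd xs) - y) * (\<rho> (last xs) - y) < 0"
      using alternates_parity[OF xs(1) xne] xs(3) by simp
    have "\<exists>ys. alternates (\<lambda>x. \<rho> x - y) ys \<and> set ys \<subseteq> insert l (insert r (set xs)) \<and> length ys = Suc (2 * size ws)"
    proof (cases "\<rho> (hd xs) > y")
      case True
      then have "alternates (\<lambda>x. \<rho> x - y) (l # xs)"
        using xs(1) xne y pos_in[of "hd xs"] zero_off[OF lr_off(1)]
        by (auto simp: alternates_Cons mult_less_0_iff)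
      then show ?thesis using xs(3) by (intro exI[of _ "l # xs"]) auto
    next
      case False
      then have "\<rho> (last xs) > y" using opp by (auto simp: mult_less_0_iff)
      then have "alternates (\<lambda>x. \<rho> x - y) (xs @ [r])"
        using xs(1) xne y pos_in[of "last xs"] zero_off[OF lr_off(2)]
        by (auto simp: alternates_def successively_append_iff mult_less_0_iff)
      then show ?thesis using xs(3) by (intro exI[of _ "xs @ [r]"]) auto
    qed
    then obtain ys where ys: "alternates (\<lambda>x. \<rho> x - y) ys" "set ys \<subseteq> insert l (insert r (set xs))"
      "length ys = Suc (2 * size ws)" by blast
    have cont: "\<forall>x\<in>set ys. isCont \<rho> x"
      using ys(2) xs(2) isCont_off lr_off by (auto simp: E_def)
    obtain e where e: "0 < e" "\<And>y'. \<bar>y' - y\<bar> < e \<Longrightarrow> alternates (\<lambda>x. \<rho> x - y') ys"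
      using alternates_robust[OF ys(1)] by blast
    show ?thesis
    proof (rule sup_num_components_ge[OF mg S])
      show "0 \<le> y" "y < y + e" using y e by auto
      fix y' assume "y < y'" "y' < y + e"
      then have "alternates (\<lambda>x. \<rho> x - y') ys" by (intro e(2)) auto
      then show "\<exists>xs. alternates (\<lambda>x. \<rho> x - y') xs \<and> (\<forall>x\<in>set xs. isCont \<rho> x) \<and> Suc (2 * size ws) = length xs"
        using cont ys(3) by (intro exI[of _ ys]) auto
    qed
  next
    case True
    have re: "Im w = 0" if "w \<in># ws" for w
      using Im_G_sign[OF nz, of w] sol[OF that] True by auto
    obtain xs where xs: "successively (\<lambda>u v. \<exists>z. u < z \<and> z < v \<and> z \<in> - \<Gamma>) xs"
      "\<forall>x\<in>set xs. 0 < \<rho> x" "set xs \<subseteq> E" "length xs = size ws"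
      using real_alternates[OF nz ne off re sol mom E] by blast
    define v where "v = Min (\<rho> ` set xs)"
    have xne: "set xs \<noteq> {}" using xs(4) ne by auto
    show ?thesis
    proof (rule sup_num_components_ge[OF mg S])
      show "0 \<le> (0::real)" "0 < v" using xs(2) xne by (auto simp: v_def)
      fix y' assume y': "0 < y'" "y' < v"
      have "\<exists>ys. alternates (\<lambda>x. \<rho> x - y') ys \<and> set ys \<subseteq> set xs \<union> - \<Gamma> \<and>
          length ys = Suc (2 * length xs) \<and> hd ys = l"
      proof (rule alternates_interleave[OF xs(1)])
        show "\<forall>x\<in>set xs. 0 < \<rho> x - y'" using y'(2) xne by (auto simp: v_def)
        show "\<forall>z\<in>- \<Gamma>. \<rho> z - y' < 0" using y'(1) zero_off by auto
        show "l \<in> - \<Gamma>" "r \<in> - \<Gamma>" using lr_off by auto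
        show "\<forall>x\<in>set xs. l < x \<and> x < r" using pos_in xs(2) by blast
      qed
      then obtain ys where ys: "alternates (\<lambda>x. \<rho> x - y') ys" "set ys \<subseteq> set xs \<union> - \<Gamma>"
        "length ys = Suc (2 * length xs)" by blast
      then have "\<forall>x\<in>set ys. isCont \<rho> x" using xs(3) isCont_off by (auto simp: E_def)
      then show "\<exists>xs. alternates (\<lambda>x. \<rho> x - y') xs \<and> (\<forall>x\<in>set xs. isCont \<rho> x) \<and> Suc (2 * size ws) = length xs"
        using ys xs(4) by (intro exI[of _ ys]) auto
    qed
  qed
qed

lemma sum_zorder_le_sup:
  assumes nz: "\<not> (AE x in lborel. \<rho> x = 0)" and mg: "has_modified_graph UNIV \<rho>"
    and S: "nowhere_dense S"
    and F: "finite F" "F \<subseteq> {z \<in> - complex_of_real ` \<Gamma>. G z = \<zeta>}"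
  shows "enat (2 * (\<Sum>z\<in>F. nat (zorder (\<lambda>w. G w - \<zeta>) z))) \<le>
    (SUP y\<in>{y. 0 < y \<and> y \<notin> S}. num_components {x. (x, y) \<in> modified_graph UNIV \<rho>})"
proof -
  define m where "m z = nat (zorder (\<lambda>w. G w - \<zeta>) z)" for z
  have "\<exists>ws. size ws = (\<Sum>z\<in>F. m z) \<and> (\<forall>w. count ws w = (if w \<in> F then m w else 0))"
    using F(1)
  proof (induction F)
    case (insert z F)
    then obtain ws where "size ws = (\<Sum>z\<in>F. m z)" "\<forall>w. count ws w = (if w \<in> F then m w else 0)"
      by blast
    then show ?case using insert
      by (intro exI[of _ "ws + replicate_mset (m z) z"]) auto
  qed (auto intro: exI[of _ "{#}"])
  then obtain ws where ws: "size ws = (\<Sum>z\<in>F. m z)" "\<And>w. count ws w = (if w \<in> F then m w else 0)"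
    by blast
  have mem: "w \<in> F" if "w \<in># ws" for w
    using that ws(2)[of w] by (auto simp flip: count_greater_zero_iff split: if_splits)
  have "enat (2 * size ws) \<le>
    (SUP y\<in>{y. 0 < y \<and> y \<notin> S}. num_components {x. (x, y) \<in> modified_graph UNIV \<rho>})"
  proof (rule twice_size_le_sup[OF nz mg S])
    fix w assume "w \<in># ws"
    then show "w \<notin> complex_of_real ` \<Gamma>" "G w = \<zeta>" using mem F(2) by auto
  next
    fix w and j :: nat assume j: "2 \<le> j" "j \<le> count ws w"
    then have "w \<in> F" "j \<le> m w" using ws(2)[of w] by (auto split: if_splits)
    then show "moment j w = 0"
      using moment_eq_0_of_zorder[of w \<zeta> j] F(2) j(1) by (auto simp: m_def)
  qed
  then show ?thesis by (simp add: ws(1) m_def)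
qed

text \<open>Equality holds on \<open>\<Gamma>\<close> too: the integrals on both sides diverge together and then have the same
  default value.\<close>

lemma stieltjes_transform_eq_G:
  assumes "measure_support (density lborel (\<lambda>x. ennreal (\<rho> x))) = \<Gamma>"
  shows "stieltjes_transform (density lborel (\<lambda>x. ennreal (\<rho> x))) = G"
proof
  fix z
  have \<Gamma>: "\<Gamma> \<in> sets borel" using compact by (simp add: borel_compact)
  have "(\<lambda>x. indicat_real \<Gamma> x *\<^sub>R (1 / (z - complex_of_real x))) \<in> borel_measurable borel"
    using \<Gamma> by measurable
  then have "stieltjes_transform (density lborel (\<lambda>x. ennreal (\<rho> x))) z =
      (LINT x|lborel. \<rho> x *\<^sub>R (indicat_real \<Gamma> x *\<^sub>R (1 / (z - complex_of_real x))))"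
    unfolding stieltjes_transform_def assms set_lebesgue_integral_def
    by (intro integral_density) (auto simp: nonneg)
  also have "\<dots> = G z"
    unfolding G_def
    by (intro Bochner_Integration.integral_cong)
      (auto simp: zero_off scaleR_conv_of_real indicator_def)
  finally show "stieltjes_transform (density lborel (\<lambda>x. ennreal (\<rho> x))) z = G z" .
qed

end

theorem theorem4p4:
  fixes \<mu> :: "real measure" and \<rho> :: "real \<Rightarrow> real"
    and n :: nat and a b :: "nat \<Rightarrow> real" and \<Gamma> :: "real set"
    and p :: real and \<zeta> :: complex and S :: "real set"
  assumes "finite_measure \<mu>"
    and "emeasure \<mu> (space \<mu>) \<noteq> 0"
    and "\<Gamma> = measure_support \<mu>"
    and "\<And>i. i < n \<Longrightarrow> a i \<le> b i"
    and "disjoint_family_on (\<lambda>i. {a i..b i}) {..<n}"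
    and "\<Gamma> = (\<Union>i<n. {a i..b i})"
    and "\<rho> \<in> borel_measurable lborel"
    and "\<And>x. 0 \<le> \<rho> x"
    and "\<And>x. x \<notin> \<Gamma> \<Longrightarrow> \<rho> x = 0"
    and "\<mu> = density lborel (\<lambda>x. ennreal (\<rho> x))"
    and "\<And>i c d. i < n \<Longrightarrow> a i < c \<Longrightarrow> c < d \<Longrightarrow> d < b i \<Longrightarrow> abs_continuous_on {c..d} \<rho>"
    and "1 < p"
    and "\<And>i c d. i < n \<Longrightarrow> a i < c \<Longrightarrow> c < d \<Longrightarrow> d < b i \<Longrightarrow> \<rho> \<in> sobolev_W1 p {c<..<d}"
    and "has_modified_graph UNIV \<rho>"
    and "nowhere_dense S"
  shows "count_solutions (stieltjes_transform \<mu>) (- complex_of_real ` \<Gamma>) \<zeta>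
           \<le> ennreal_of_enat
                (SUP y\<in>{y. 0 < y \<and> y \<notin> S}. num_components {x. (x, y) \<in> modified_graph UNIV \<rho>}) / 2"
proof -
  have mass: "emeasure \<mu> (space \<mu>) = (\<integral>\<^sup>+x. ennreal (\<rho> x) \<partial>lborel)"
    using assms(7) unfolding assms(10) by (simp add: emeasure_density)
  have "(\<integral>\<^sup>+x. ennreal (\<rho> x) \<partial>lborel) < \<infinity>"
    using finite_measure.finite_emeasure_space[OF assms(1)] mass by (simp add: less_top)
  then have int: "integrable lborel \<rho>"
    using assms(7,8) by (intro integrableI_nonneg) auto
  interpret compact_density \<rho> \<Gamma>
    using int assms(8,9) by unfold_locales (auto simp: assms(6))
  have nz: "\<not> (AE x in lborel. \<rho> x = 0)"
  proof
    assume "AE x in lborel. \<rho> x = 0"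
    then have "(\<integral>\<^sup>+x. ennreal (\<rho> x) \<partial>lborel) = 0"
      using assms(7) by (subst nn_integral_0_iff_AE) (auto elim: eventually_mono)
    then show False using assms(2) mass by simp
  qed
  have st: "stieltjes_transform \<mu> = G"
    using stieltjes_transform_eq_G assms(3) unfolding assms(10) by simp
  let ?X = "SUP y\<in>{y. 0 < y \<and> y \<notin> S}. num_components {x. (x, y) \<in> modified_graph UNIV \<rho>}"
  let ?m = "\<lambda>z. nat (zorder (\<lambda>w. G w - \<zeta>) z)"
  have "(\<Sum>z\<in>F. of_nat (?m z)) \<le> ennreal_of_enat ?X / 2"
    if F: "finite F" "F \<subseteq> {z \<in> - complex_of_real ` \<Gamma>. G z = \<zeta>}" for F
  proof -
    have "ennreal_of_enat (enat (2 * (\<Sum>z\<in>F. ?m z))) \<le> ennreal_of_enat ?X"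
      using sum_zorder_le_sup[OF nz assms(14,15) F] by (simp only: ennreal_of_enat_le_iff)
    then have "of_nat (\<Sum>z\<in>F. ?m z) * 2 \<le> ennreal_of_enat ?X"
      by (simp add: mult.commute)
    then have "of_nat (\<Sum>z\<in>F. ?m z) * 2 / 2 \<le> ennreal_of_enat ?X / 2"
      by (rule divide_right_mono_ennreal)
    then show ?thesis
      by (subst (asm) mult_divide_eq_ennreal) auto
  qed
  then show ?thesis
    unfolding count_solutions_def st
    by (subst nonneg_infsum_complete) (auto intro!: SUP_least)
qed

end
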